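(* Every symmetric, product, log-concave probability measure on $\mathbb{R}^n$ with fully dimensional support satisfies $\mathrm{IC}(C)$ with a universal constant $C=2\sqrt{3}\delta\approx 9.61929\ldots$, where $\delta>0$ is such that $\Lambda^*_\nu(\delta)=\ln 2+1/\sqrt{3}$.
   Context: $\nu$ is the symmetric exponential distribution with density $\frac12 e^{-|x|}$. A measure $\mu$ is log-concave if $\mu(tA+(1-t)B)\ge\mu(A)^t\mu(B)^{1-t}$ for nonempty compact $A,B$ and $t\in[0,1]$; fully dimensional support means the support is not contained in a proper affine subspace. A pair $(\mu,W)$, with $\mu$ a probability measure on $\mathbb{R}^n$ and $W:\mathbb{R}^n\to[0,\infty]$, satisfies property $(\tau)$ if for every bounded function $f$, $\int e^{h}\,d\mu\int e^{-f}\,d\mu\le 1$, where $h(x)=\inf_{y}\{W(x-y)+f(y)\}$ is the infimum convolution of $W$ and $f$. For a measure $\mu$, $\mu'$ is its reflection through the origin, $\overline{\mu}=\mu*\mu'$, $\Lambda_\mu=\ln\int e^{\langle \cdot,y\rangle}d\mu(y)$, and $\Lambda^*_\mu(x)=\sup_y\{\langle x,y\rangle-\Lambda_\mu(y)\}$. A probability measure $\mu$ satisfies $\mathrm{IC}(\beta)$ ($\beta>0$) if the pair $(\mu,\Lambda^*_{\overline{\mu}}(\cdot/\beta))$ satisfies property $(\tau)$. *)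

theory Defs
  imports "HOL-Probability.Probability"
begin

definition mink_comb :: "real \<Rightarrow> 'a::real_vector set \<Rightarrow> 'a set \<Rightarrow> 'a set" where
  "mink_comb t A B = {t *\<^sub>R a + (1 - t) *\<^sub>R b | a b. a \<in> A \<and> b \<in> B}"

definition log_concave_measure :: "'a::euclidean_space measure \<Rightarrow> bool" where
  "log_concave_measure M \<longleftrightarrow>
     (\<forall>A B t. compact A \<and> compact B \<and> A \<noteq> {} \<and> B \<noteq> {} \<and> 0 \<le> t \<and> t \<le> 1 \<longrightarrow>
        measure M (mink_comb t A B) \<ge> measure M A powr t * measure M B powr (1 - t))"

definition reflect_measure :: "'a::euclidean_space measure \<Rightarrow> 'a measure" where
  "reflect_measure M = distr M borel uminus"

definition symmetric_measure :: "'a::euclidean_space measure \<Rightarrow> bool" where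
  "symmetric_measure M \<longleftrightarrow> reflect_measure M = M"

definition conv_measure :: "'a::euclidean_space measure \<Rightarrow> 'a measure \<Rightarrow> 'a measure" where
  "conv_measure M N = distr (M \<Otimes>\<^sub>M N) borel (\<lambda>(x, y). x + y)"

definition symmetrization :: "'a::euclidean_space measure \<Rightarrow> 'a measure" where
  "symmetrization M = conv_measure M (reflect_measure M)"

definition product_measure :: "(real ^ 'n) measure \<Rightarrow> bool" where
  "product_measure M \<longleftrightarrow>
     (\<exists>Ms :: 'n \<Rightarrow> real measure. (\<forall>i. prob_space (Ms i) \<and> sets (Ms i) = sets borel) \<and>
        M = distr (PiM UNIV Ms) borel (\<lambda>f. \<chi> i. f i))"

definition msupport :: "'a::metric_space measure \<Rightarrow> 'a set" where
  "msupport M = {x. \<forall>e>0. emeasure M (ball x e) > 0}"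

definition full_dim_support :: "'a::euclidean_space measure \<Rightarrow> bool" where
  "full_dim_support M \<longleftrightarrow> affine hull (msupport M) = UNIV"

definition log_laplace :: "'a::euclidean_space measure \<Rightarrow> 'a \<Rightarrow> ereal" where
  "log_laplace M y =
     (let I = (\<integral>\<^sup>+ x. ennreal (exp (x \<bullet> y)) \<partial>M)
      in if I = \<infinity> then \<infinity> else ereal (ln (enn2real I)))"

definition log_laplace_conj :: "'a::euclidean_space measure \<Rightarrow> 'a \<Rightarrow> ereal" where
  "log_laplace_conj M x = (SUP y. ereal (x \<bullet> y) - log_laplace M y)"

definition eexp :: "ereal \<Rightarrow> ennreal" where
  "eexp z = (case z of ereal r \<Rightarrow> ennreal (exp r) | PInfty \<Rightarrow> \<infinity> | MInfty \<Rightarrow> 0)"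

definition inf_conv :: "('a::real_vector \<Rightarrow> ereal) \<Rightarrow> ('a \<Rightarrow> real) \<Rightarrow> 'a \<Rightarrow> ereal" where
  "inf_conv W f x = (INF y. W (x - y) + ereal (f y))"

definition property_tau :: "'a::euclidean_space measure \<Rightarrow> ('a \<Rightarrow> ereal) \<Rightarrow> bool" where
  "property_tau M W \<longleftrightarrow>
     (\<forall>f. f \<in> borel_measurable borel \<and> bounded (range f) \<longrightarrow>
        (\<integral>\<^sup>+ x. eexp (inf_conv W f x) \<partial>M) * (\<integral>\<^sup>+ x. ennreal (exp (- f x)) \<partial>M) \<le> 1)"

definition IC :: "real \<Rightarrow> 'a::euclidean_space measure \<Rightarrow> bool" where
  "IC \<beta> M \<longleftrightarrow> property_tau M (\<lambda>x. log_laplace_conj (symmetrization M) ((1 / \<beta>) *\<^sub>R x))"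

definition sym_exp :: "real measure" where
  "sym_exp = density lborel (\<lambda>x. ennreal (exp (- \<bar>x\<bar>) / 2))"

end

(*
Property (tau) passes to products and to images, so it suffices to treat one-dimensional marginals M.
Under the substitution |xi| = 1 - exp(-|x|/2) the symmetric exponential law becomes the triangular law
with density rho = 1 - |xi| on [-1,1]. The Prekopa-Leindler inequality for rho, which follows from
comparing lengths of level sets, gives property (tau) with the kernel
rho((xi+eta)/2)^2 / (rho(xi) rho(eta)) >= cosh((x-y)/4)^2.

The monotone map T from the symmetric exponential law onto M is odd and concave on [0,oo), so
|T x - T y| <= 2 T(s) with s = |x-y|/2. Since the log-Laplace transform of the symmetrization of M is
2 ln m, with m the moment generating function of M, it remains to show
exp(l T(s) / beta) <= m(l) cosh(s/2). For large s this follows from m(l) >= exp(l T(s) - s)/2. For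
small s, log-concavity of the distribution function across the origin gives
T(u) >= (T(s)/s) ln 2 (1 - exp(-u)), hence m(l) >= sinh(k)/k with k = l ln 2 T(s)/s. Any beta >= 7.7
suffices, and the hypothesis on delta gives this because the log-Laplace transform of the symmetric
exponential law is at least y^2.
*)
theory Submission
  imports Defs "HOL-Real_Asymp.Real_Asymp"
begin

section \<open>Exponential and hyperbolic estimates\<close>

text \<open>Neither lower bound on the moment generating function works for all s. The tail bound
  carries a factor 1/2, so it says nothing near l = 0, where m(l) is close to 1; it becomes
  affordable once cosh (s/2) is large enough to absorb the loss of ln 2. For small s both cosh (s/2)
  and m(l) may be only 1 plus a quadratic term, so a second-order lower bound for m is needed,
  expressed through the slope T(s)/s alone; the product of the two quadratic effects is then handled
  by completing a square.

  The exponent 1/2 in the substitution does two jobs. It makes the density exp(-|x|/2) = 1 - |xi|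
  concave in the new variable, with intervals centred at 0 as level sets. It also makes the
  resulting kernel a perfect square, which matches the square m(l)^2 produced by the symmetrization,
  so that the final inequality can be proved for square roots.\<close>

lemma cosh_ge_quartic: "1 + x\<^sup>2 / 2 + x ^ 4 / 24 \<le> cosh (x::real)"
proof -
  have "{..<5} = {0, 1, 2, 3, 4 :: nat}" by auto
  have "(\<Sum>n<5. if even n then x ^ n /\<^sub>R fact n else 0) \<le> (\<Sum>n. if even n then x ^ n /\<^sub>R fact n else 0)"
    using sums_summable[OF cosh_converges[of x]]
    by (intro sum_le_suminf) (auto simp: zero_le_even_power)
  also have "\<dots> = cosh x"
    using cosh_converges[of x] by (simp add: sums_iff)
  finally show ?thesis
    by (simp add: \<open>{..<5} = {0, 1, 2, 3, 4}\<close> fact_numeral field_simps)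
qed

lemma sinh_ge_quintic: "0 \<le> x \<Longrightarrow> x + x ^ 3 / 6 + x ^ 5 / 120 \<le> sinh (x::real)"
proof -
  assume x: "0 \<le> x"
  have "{..<6} = {0, 1, 2, 3, 4, 5 :: nat}" by auto
  have "(\<Sum>n<6. if even n then 0 else x ^ n /\<^sub>R fact n) \<le> (\<Sum>n. if even n then 0 else x ^ n /\<^sub>R fact n)"
    using sums_summable[OF sinh_converges[of x]] x by (intro sum_le_suminf) auto
  also have "\<dots> = sinh x"
    using sinh_converges[of x] by (simp add: sums_iff)
  finally show ?thesis
    by (simp add: \<open>{..<6} = {0, 1, 2, 3, 4, 5}\<close> fact_numeral field_simps)
qed

text \<open>With y = s^2/11 the quartic Taylor polynomial of cosh (s/2) is 1 + 11/8 y + 121/384 y^2.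
  Its surplus 3/8 y over 1 + y pays for the rest of y^2 as long as y <= 144/263, and s <= 12/5 keeps
  y below 53/100.\<close>

lemma exp_le_cosh_half:
  fixes s :: real
  assumes "0 \<le> s" "s \<le> 12 / 5"
  shows "exp (s\<^sup>2 / 11) \<le> cosh (s / 2)"
proof -
  define y where "y = s\<^sup>2 / 11"
  have "s\<^sup>2 \<le> (12 / 5)\<^sup>2" using assms by (intro power_mono) auto
  then have y: "0 \<le> y" "y \<le> 53 / 100" by (simp_all add: y_def power2_eq_square)
  have "exp y \<le> 1 + y + y\<^sup>2" using y by (intro exp_bound) auto
  also have "\<dots> \<le> 1 + 11 / 8 * y + 121 / 384 * y\<^sup>2"
    using mult_right_mono[OF y(2) y(1)] y by (simp add: power2_eq_square)
  also have "\<dots> = 1 + (s / 2)\<^sup>2 / 2 + (s / 2) ^ 4 / 24"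
    by (simp add: y_def power2_eq_square power4_eq_xxxx)
  also have "\<dots> \<le> cosh (s / 2)" by (rule cosh_ge_quartic)
  finally show ?thesis by (simp add: y_def)
qed

lemma exp_quadratic_le_sinh:
  fixes l :: real
  assumes "0 \<le> l" "l \<le> 3"
  shows "l * exp (l\<^sup>2 / 9) \<le> sinh l"
proof -
  define y where "y = l\<^sup>2 / 9"
  have "l\<^sup>2 \<le> 3\<^sup>2" using assms by (intro power_mono) auto
  then have y: "0 \<le> y" "y \<le> 1" by (simp_all add: y_def)
  have "exp y \<le> 1 + y + y\<^sup>2" using y by (intro exp_bound) auto
  also have "\<dots> \<le> 1 + 3 / 2 * y + 81 / 120 * y\<^sup>2"
    using mult_right_mono[OF y(2) y(1)] y by (simp add: power2_eq_square)
  finally have "l * exp y \<le> l * (1 + 3 / 2 * y + 81 / 120 * y\<^sup>2)"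
    using assms by (intro mult_left_mono)
  also have "\<dots> = l + l ^ 3 / 6 + l ^ 5 / 120"
    by (simp add: y_def field_simps eval_nat_numeral)
  also have "\<dots> \<le> sinh l" using assms by (intro sinh_ge_quintic) auto
  finally show ?thesis by (simp add: y_def)
qed

text \<open>The exponent continues l^2/9 beyond l = 3: both equal 1 there. The slope 1/2 exceeds s/5
  for every s <= 12/5, which is what \<open>exp_mult_le_cosh_sinh\<close> needs for large l.\<close>

lemma exp_linear_le_sinh:
  fixes l :: real
  assumes "3 \<le> l"
  shows "l * exp ((l - 1) / 2) \<le> sinh l"
proof -
  have e: "5 / 2 \<le> exp (1::real)"
    using exp_lower_Taylor_quadratic[of 1] by simp
  have e2: "25 / 4 \<le> exp (2::real)"
    using mult_mono[OF e e] by (simp flip: exp_add)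
  have "50 \<le> (25 / 4) * (25 / 4) * (25 / 4 :: real)" by simp
  also have "\<dots> \<le> exp 2 * exp 2 * exp 2"
    by (intro mult_mono e2) auto
  also have "\<dots> \<le> exp (2 * l)"
    using assms by (simp flip: exp_add)
  finally have "50 * exp (- l) \<le> exp (2 * l) * exp (- l)"
    by (intro mult_right_mono) auto
  also have "\<dots> = exp l" by (simp flip: exp_add)
  finally have s: "49 / 100 * exp l \<le> sinh l"
    by (simp add: sinh_field_def)
  \<comment> \<open>The tangent of the exponential is taken at 2, the value of (l + 1)/2 at l = 3.
    There is little room at that point: 3.0625 against 3.\<close>
  have "l \<le> 49 / 100 * (25 / 4 * ((l + 1) / 2 - 1))"
    using assms by (simp add: field_simps)
  also have "\<dots> \<le> 49 / 100 * (exp 2 * exp ((l + 1) / 2 - 2))"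
    using exp_ge_add_one_self[of "(l + 1) / 2 - 2"] assms
    by (intro mult_left_mono mult_mono e2) auto
  also have "\<dots> = 49 / 100 * exp ((l + 1) / 2)"
    by (simp flip: exp_add)
  finally have "l * exp ((l - 1) / 2) \<le> 49 / 100 * exp ((l + 1) / 2) * exp ((l - 1) / 2)"
    by (intro mult_right_mono) auto
  also have "\<dots> = 49 / 100 * exp l"
    by (simp add: field_simps flip: exp_add)
  finally show ?thesis using s by linarith
qed

lemma exp_mult_le_cosh_sinh:
  fixes s l B :: real
  assumes s: "0 \<le> s" "s \<le> 12 / 5" and l: "0 \<le> l" and B: "5 \<le> B"
  shows "l * exp (l * s / B) \<le> cosh (s / 2) * sinh l"
proof -
  have "l * s / B \<le> l * s / 5"
    using s l B by (intro divide_left_mono) auto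
  then have 1: "l * exp (l * s / B) \<le> l * exp (l * s / 5)"
    using l by (intro mult_left_mono) auto
  show ?thesis
  proof (cases "l \<le> 3")
    case True
    \<comment> \<open>The square is balanced so that s^2 receives 1/11, as in
      \<open>exp_le_cosh_half\<close>; then l^2 receives 11/100, just below the 1/9 of
      \<open>exp_quadratic_le_sinh\<close>.\<close>
    have "0 \<le> (s - 11 / 10 * l)\<^sup>2 / 11" by simp
    also have "\<dots> = s\<^sup>2 / 11 - l * s / 5 + 11 / 100 * l\<^sup>2"
      by (simp add: power2_eq_square field_simps)
    finally have "l * s / 5 \<le> s\<^sup>2 / 11 + 11 / 100 * l\<^sup>2" by simp
    also have "\<dots> \<le> s\<^sup>2 / 11 + l\<^sup>2 / 9" using zero_le_power2[of l] by linarith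
    finally have "l * exp (l * s / 5) \<le> l * exp (s\<^sup>2 / 11 + l\<^sup>2 / 9)"
      using l by (intro mult_left_mono) auto
    also have "\<dots> = exp (s\<^sup>2 / 11) * (l * exp (l\<^sup>2 / 9))" by (simp add: exp_add)
    also have "\<dots> \<le> cosh (s / 2) * sinh l"
      using l True by (intro mult_mono exp_le_cosh_half exp_quadratic_le_sinh s) auto
    finally show ?thesis using 1 by simp
  next
    case False
    \<comment> \<open>Split l = 3 + (l - 3): this product bounds (l - 3) s/5 by (l - 3)/2, and the
      square below bounds 3 s/5 by s^2/11 + 1.\<close>
    have "0 \<le> (l - 3) * (1 / 2 - s / 5)"
      using False s by (intro mult_nonneg_nonneg) auto
    moreover have "0 \<le> (s - 33 / 10)\<^sup>2" by simp
    then have "0 \<le> 1 - 3 / 5 * s + s\<^sup>2 / 11" by (simp add: power2_eq_square field_simps)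
    ultimately have "l * s / 5 \<le> s\<^sup>2 / 11 + (l - 1) / 2" by (simp add: field_simps)
    then have "l * exp (l * s / 5) \<le> l * exp (s\<^sup>2 / 11 + (l - 1) / 2)"
      using l by (intro mult_left_mono) auto
    also have "\<dots> = exp (s\<^sup>2 / 11) * (l * exp ((l - 1) / 2))" by (simp add: exp_add)
    also have "\<dots> \<le> cosh (s / 2) * sinh l"
      using l False by (intro mult_mono exp_le_cosh_half exp_linear_le_sinh s) auto
    finally show ?thesis using 1 by simp
  qed
qed

text \<open>Since cosh (s/2) is at least exp (s/2 - ln 2), only a linear inequality in s remains,
  and it already holds at the threshold 12/5.\<close>

lemma exp_le_cosh_half_large:
  fixes s \<beta> :: real
  assumes s: "12 / 5 \<le> s" and \<beta>: "77 / 10 \<le> \<beta>"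
  shows "exp ((s + ln 2) / \<beta>) \<le> cosh (s / 2)"
proof -
  have "(s + ln 2) / \<beta> \<le> (s + ln 2) / (77 / 10)"
    using s \<beta> by (intro divide_left_mono) (auto simp: add_nonneg_nonneg)
  also have "\<dots> \<le> s / 2 - ln 2"
    using s ln2_le_25_over_36 by simp
  finally have "exp ((s + ln 2) / \<beta>) \<le> exp (s / 2 - ln 2)" by simp
  also have "\<dots> \<le> cosh (s / 2)" by (simp add: exp_diff cosh_field_def)
  finally show ?thesis .
qed

lemma cosh_half_ln_power2:
  fixes r :: real
  assumes "0 < r"
  shows "(cosh (ln r / 2))\<^sup>2 = (r + 1 / r + 2) / 4"
  using cosh_double_cosh[of "ln r / 2"] cosh_ln_real[OF assms] by (simp add: field_simps)

text \<open>The chord of the concave function ln (1 + p) over [0, 1]. It is the origin of the factor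
  ln 2 in \<open>tail_quantile_lower\<close>.\<close>

lemma mult_ln_2_le_ln_1_plus:
  fixes p :: real
  assumes "0 \<le> p" "p \<le> 1"
  shows "p * ln 2 \<le> ln (1 + p)"
proof -
  have "exp ((1 - p) *\<^sub>R 0 + p *\<^sub>R ln 2) \<le> (1 - p) * exp 0 + p * exp (ln 2 :: real)"
    using assms exp_convex by (intro convex_onD) auto
  then have "exp (p * ln 2) \<le> 1 + p" by (simp add: algebra_simps)
  then show ?thesis using assms by (subst ln_ge_iff) auto
qed


lemma borel_measurable_cosh[measurable (raw)]:
  fixes f :: "'a \<Rightarrow> real"
  assumes [measurable]: "f \<in> borel_measurable M"
  shows "(\<lambda>x. cosh (f x)) \<in> borel_measurable M"
  unfolding cosh_field_def by measurable


section \<open>Property (tau) for kernels\<close>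

text \<open>Here \<open>a\<close>, \<open>b\<close> and \<open>k\<close> stand for \<open>exp h\<close>, \<open>exp (- f)\<close> and \<open>exp W\<close>; avoiding the infimum
  convolution makes the property visibly stable under images and products.\<close>

definition tau_kernel :: "'a measure \<Rightarrow> ('a \<Rightarrow> 'a \<Rightarrow> ennreal) \<Rightarrow> bool" where
  "tau_kernel M k \<longleftrightarrow>
     (\<forall>a\<in>borel_measurable M. \<forall>b\<in>borel_measurable M.
        (\<forall>x\<in>space M. \<forall>y\<in>space M. a x * b y \<le> k x y) \<longrightarrow>
        (\<integral>\<^sup>+x. a x \<partial>M) * (\<integral>\<^sup>+x. b x \<partial>M) \<le> 1)"

lemma tau_kernelI:
  assumes "\<And>a b :: 'a \<Rightarrow> ennreal. a \<in> borel_measurable M \<Longrightarrow> b \<in> borel_measurable M \<Longrightarrow>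
      (\<And>x y. x \<in> space M \<Longrightarrow> y \<in> space M \<Longrightarrow> a x * b y \<le> k x y) \<Longrightarrow>
      (\<integral>\<^sup>+x. a x \<partial>M) * (\<integral>\<^sup>+x. b x \<partial>M) \<le> 1"
  shows "tau_kernel M k"
  using assms by (auto simp: tau_kernel_def)

lemma tau_kernelD:
  assumes "tau_kernel M k" "a \<in> borel_measurable M" "b \<in> borel_measurable M"
    and "\<And>x y. x \<in> space M \<Longrightarrow> y \<in> space M \<Longrightarrow> a x * b y \<le> k x y"
  shows "(\<integral>\<^sup>+x. a x \<partial>M) * (\<integral>\<^sup>+x. b x \<partial>M) \<le> 1"
  using assms by (auto simp: tau_kernel_def)

lemma tau_kernel_distr:
  assumes k: "tau_kernel M k" and f[measurable]: "f \<in> measurable M N"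
    and le: "\<And>x y. x \<in> space M \<Longrightarrow> y \<in> space M \<Longrightarrow> k' (f x) (f y) \<le> k x y"
  shows "tau_kernel (distr M N f) k'"
proof (rule tau_kernelI)
  fix a b :: "'b \<Rightarrow> ennreal"
  assume "a \<in> borel_measurable (distr M N f)" "b \<in> borel_measurable (distr M N f)"
  then have [measurable]: "a \<in> borel_measurable N" "b \<in> borel_measurable N" by simp_all
  assume ab: "\<And>x y. x \<in> space (distr M N f) \<Longrightarrow> y \<in> space (distr M N f) \<Longrightarrow> a x * b y \<le> k' x y"
  have "(\<integral>\<^sup>+x. a (f x) \<partial>M) * (\<integral>\<^sup>+x. b (f x) \<partial>M) \<le> 1"
  proof (rule tau_kernelD[OF k])
    fix x y assume xy: "x \<in> space M" "y \<in> space M"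
    then have "a (f x) * b (f y) \<le> k' (f x) (f y)"
      using measurable_space[OF f] by (intro ab) auto
    also have "\<dots> \<le> k x y" by (rule le[OF xy])
    finally show "a (f x) * b (f y) \<le> k x y" .
  qed measurable
  then show "(\<integral>\<^sup>+x. a x \<partial>distr M N f) * (\<integral>\<^sup>+x. b x \<partial>distr M N f) \<le> 1"
    by (simp add: nn_integral_distr)
qed

text \<open>Divide \<open>a\<close> by \<open>c\<close>. In the induction over coordinates
  \<open>c\<close> is the kernel of the other coordinates, which is constant, possibly infinite,
  while one coordinate is integrated.\<close>

lemma tau_kernel_scaled:
  assumes k: "tau_kernel M k" and [measurable]: "a \<in> borel_measurable M" "b \<in> borel_measurable M"
    and le: "\<And>x y. x \<in> space M \<Longrightarrow> y \<in> space M \<Longrightarrow> a x * b y \<le> c * k x y"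
    and c: "c \<noteq> 0"
  shows "(\<integral>\<^sup>+x. a x \<partial>M) * (\<integral>\<^sup>+x. b x \<partial>M) \<le> c"
proof (cases "c = \<infinity>")
  case False
  have inv: "c * inverse c = 1"
    using c False by (simp add: top.not_eq_extremum flip: divide_ennreal_def)
  have "(\<integral>\<^sup>+x. inverse c * a x \<partial>M) * (\<integral>\<^sup>+x. b x \<partial>M) \<le> 1"
  proof (rule tau_kernelD[OF k])
    fix x y assume xy: "x \<in> space M" "y \<in> space M"
    have "inverse c * (a x * b y) \<le> inverse c * (c * k x y)"
      by (intro mult_left_mono le xy) auto
    also have "\<dots> = c * inverse c * k x y" by (simp only: ac_simps)
    finally show "inverse c * a x * b y \<le> k x y"
      by (simp add: inv mult.assoc)
  qed measurable
  then have "c * (inverse c * (\<integral>\<^sup>+x. a x \<partial>M) * (\<integral>\<^sup>+x. b x \<partial>M)) \<le> c * 1"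
    by (intro mult_left_mono) (simp_all add: nn_integral_cmult)
  also have "c * (inverse c * (\<integral>\<^sup>+x. a x \<partial>M) * (\<integral>\<^sup>+x. b x \<partial>M)) =
      c * inverse c * ((\<integral>\<^sup>+x. a x \<partial>M) * (\<integral>\<^sup>+x. b x \<partial>M))"
    by (simp only: ac_simps)
  finally show ?thesis by (simp add: inv)
qed simp

text \<open>With the other coordinates of x and y fixed, the property of the new factor bounds the
  product of the two integrals over that coordinate by the kernel of the others. So the partially
  integrated functions satisfy the hypothesis of the induction. Kernels that are at least 1 keep the
  scaling constant away from 0.\<close>

lemma tau_kernel_PiM:
  fixes M :: "'i \<Rightarrow> 'a measure"
  assumes "finite I" and sf: "\<And>i. sigma_finite_measure (M i)"
    and k: "\<And>i. i \<in> I \<Longrightarrow> tau_kernel (M i) (k i)"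
    and ge1: "\<And>i x y. i \<in> I \<Longrightarrow> 1 \<le> k i x y"
  shows "tau_kernel (PiM I M) (\<lambda>x y. \<Prod>i\<in>I. k i (x i) (y i))"
  using \<open>finite I\<close> k ge1
proof (induction I rule: finite_induct)
  case empty
  interpret product_sigma_finite M by (rule product_sigma_finite.intro) (rule sf)
  show ?case
    by (rule tau_kernelI) (simp add: nn_integral_empty space_PiM)
next
  case (insert i I)
  interpret product_sigma_finite M by (rule product_sigma_finite.intro) (rule sf)
  show ?case
  proof (rule tau_kernelI)
    fix a b :: "('i \<Rightarrow> 'a) \<Rightarrow> ennreal"
    assume [measurable]: "a \<in> borel_measurable (PiM (insert i I) M)" "b \<in> borel_measurable (PiM (insert i I) M)"
    assume ab: "\<And>x y. x \<in> space (PiM (insert i I) M) \<Longrightarrow> y \<in> space (PiM (insert i I) M) \<Longrightarrow>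
      a x * b y \<le> (\<Prod>j\<in>insert i I. k j (x j) (y j))"
    have upd: "x(i := \<xi>) \<in> space (PiM (insert i I) M)"
      if "x \<in> space (PiM I M)" "\<xi> \<in> space (M i)" for x \<xi>
      using that by (auto simp: space_PiM PiE_def extensional_def)
    interpret sigma_finite_measure "M i" by (rule sf)
    have [measurable]: "(\<lambda>x. \<integral>\<^sup>+\<xi>. a (x(i := \<xi>)) \<partial>M i) \<in> borel_measurable (PiM I M)"
      "(\<lambda>x. \<integral>\<^sup>+\<xi>. b (x(i := \<xi>)) \<partial>M i) \<in> borel_measurable (PiM I M)"
      by measurable
    have [measurable]: "(\<lambda>\<xi>. x(i := \<xi>)) \<in> measurable (M i) (PiM (insert i I) M)"
      if "x \<in> space (PiM I M)" for x
      using that by measurable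
    have "(\<integral>\<^sup>+x. (\<integral>\<^sup>+\<xi>. a (x(i := \<xi>)) \<partial>M i) \<partial>PiM I M) * (\<integral>\<^sup>+x. (\<integral>\<^sup>+\<xi>. b (x(i := \<xi>)) \<partial>M i) \<partial>PiM I M) \<le> 1"
    proof (rule tau_kernelD[OF insert.IH])
      fix x y assume xy: "x \<in> space (PiM I M)" "y \<in> space (PiM I M)"
      show "(\<integral>\<^sup>+\<xi>. a (x(i := \<xi>)) \<partial>M i) * (\<integral>\<^sup>+\<xi>. b (y(i := \<xi>)) \<partial>M i) \<le> (\<Prod>j\<in>I. k j (x j) (y j))"
      proof (rule tau_kernel_scaled[where k = "k i"])
        show "tau_kernel (M i) (k i)" using insert.prems by simp
        have "1 \<le> (\<Prod>j\<in>I. k j (x j) (y j))"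
          by (intro prod_ge_1) (simp_all add: insert.prems)
        then show "(\<Prod>j\<in>I. k j (x j) (y j)) \<noteq> 0"
          by (metis not_one_le_zero)
        fix \<xi> \<eta> assume "\<xi> \<in> space (M i)" "\<eta> \<in> space (M i)"
        then have "a (x(i := \<xi>)) * b (y(i := \<eta>)) \<le> (\<Prod>j\<in>insert i I. k j ((x(i := \<xi>)) j) ((y(i := \<eta>)) j))"
          by (intro ab upd xy)
        also have "\<dots> = (\<Prod>j\<in>I. k j (x j) (y j)) * k i \<xi> \<eta>"
          using insert.hyps by (auto simp: mult.commute intro!: arg_cong2[where f = "(*)"] prod.cong)
        finally show "a (x(i := \<xi>)) * b (y(i := \<eta>)) \<le> (\<Prod>j\<in>I. k j (x j) (y j)) * k i \<xi> \<eta>" .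
      qed (use xy in measurable)
    qed (use insert.prems in simp_all)
    then show "(\<integral>\<^sup>+x. a x \<partial>PiM (insert i I) M) * (\<integral>\<^sup>+x. b x \<partial>PiM (insert i I) M) \<le> 1"
      using insert.hyps by (simp add: product_nn_integral_insert)
  qed
qed

section \<open>The triangular law\<close>

lemma nn_integral_layer_cake:
  fixes f :: "real \<Rightarrow> real"
  assumes [measurable]: "f \<in> borel_measurable borel" and "\<And>x. 0 \<le> f x"
  shows "(\<integral>\<^sup>+x. ennreal (f x) \<partial>lborel) = (\<integral>\<^sup>+t. emeasure lborel {x. t < f x} * indicator {0..} t \<partial>lborel)"
proof -
  have "(\<integral>\<^sup>+x. ennreal (f x) \<partial>lborel) = (\<integral>\<^sup>+x. (\<integral>\<^sup>+t. indicator {t. 0 \<le> t \<and> t < f x} t \<partial>lborel) \<partial>lborel)"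
  proof (intro nn_integral_cong)
    fix x
    have "{t. 0 \<le> t \<and> t < f x} = {0..<f x}" by auto
    then show "ennreal (f x) = (\<integral>\<^sup>+t. indicator {t. 0 \<le> t \<and> t < f x} t \<partial>lborel)"
      using assms(2)[of x] by simp
  qed
  also have "\<dots> = (\<integral>\<^sup>+t. (\<integral>\<^sup>+x. indicator {t. 0 \<le> t \<and> t < f x} t \<partial>lborel) \<partial>lborel)"
    by (rule lborel_pair.Fubini'[symmetric]) measurable
  also have "\<dots> = (\<integral>\<^sup>+t. (\<integral>\<^sup>+x. indicator {x. t < f x} x * indicator {0..} t \<partial>lborel) \<partial>lborel)"
    by (intro nn_integral_cong) (auto simp: indicator_def)
  also have "\<dots> = (\<integral>\<^sup>+t. emeasure lborel {x. t < f x} * indicator {0..} t \<partial>lborel)"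
    by (intro nn_integral_cong) (simp add: nn_integral_multc)
  finally show ?thesis .
qed

lemma emeasure_lborel_le_Sup_Inf:
  fixes A :: "real set"
  assumes [measurable]: "A \<in> sets borel" and "A \<noteq> {}" "bdd_above A" "bdd_below A"
  shows "emeasure lborel A \<le> ennreal (Sup A - Inf A)"
proof -
  have "A \<subseteq> {Inf A..Sup A}"
    using assms by (auto intro: cInf_lower cSup_upper)
  then have "emeasure lborel A \<le> emeasure lborel {Inf A..Sup A}"
    by (intro emeasure_mono) auto
  also have "\<dots> = ennreal (Sup A - Inf A)"
    using assms by (intro emeasure_lborel_Icc cInf_le_cSup)
  finally show ?thesis .
qed

text \<open>The suprema of \<open>A\<close> and \<open>B\<close> add up to at most c and the infima
  to at least -c; each set is no longer than its supremum minus its infimum.\<close>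

lemma emeasure_midpoint_constraint_le:
  fixes A B :: "real set" and c :: real
  assumes [measurable]: "A \<in> sets borel" "B \<in> sets borel" and ne: "A \<noteq> {}" "B \<noteq> {}"
    and bdd: "A \<subseteq> {-1..1}" "B \<subseteq> {-1..1}"
    and le: "\<And>x y. x \<in> A \<Longrightarrow> y \<in> B \<Longrightarrow> \<bar>x + y\<bar> \<le> c"
  shows "emeasure lborel A + emeasure lborel B \<le> ennreal (2 * c)"
proof -
  have b: "bdd_above A" "bdd_below A" "bdd_above B" "bdd_below B"
    using bdd bdd_above_mono[of "{-1..1::real}"] bdd_below_mono[of "{-1..1::real}"] by auto
  have "Sup A \<le> c - y" if "y \<in> B" for y
    using le[OF _ that] by (intro cSup_least ne) (auto simp: abs_le_iff algebra_simps)
  then have "Sup B \<le> c - Sup A"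
    by (intro cSup_least ne) (auto simp: algebra_simps)
  moreover have "- c - y \<le> Inf A" if "y \<in> B" for y
    using le[OF _ that] by (intro cInf_greatest ne) (force simp: abs_le_iff)
  then have "- c - Inf A \<le> Inf B"
    by (intro cInf_greatest ne) (auto simp: algebra_simps)
  ultimately have "(Sup A - Inf A) + (Sup B - Inf B) \<le> 2 * c" by simp
  have "emeasure lborel A + emeasure lborel B \<le> ennreal (Sup A - Inf A) + ennreal (Sup B - Inf B)"
    by (intro add_mono emeasure_lborel_le_Sup_Inf b ne) auto
  also have "\<dots> = ennreal ((Sup A - Inf A) + (Sup B - Inf B))"
    using b ne by (intro ennreal_plus[symmetric]) (auto intro: cInf_le_cSup)
  also have "\<dots> \<le> ennreal (2 * c)"
    by (rule ennreal_leI) fact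
  finally show ?thesis .
qed

text \<open>Additive form of Prekopa-Leindler for functions with equal suprema, whose level sets at
  height t are nonempty together. Midpoints of these level sets lie where the triangular density
  exceeds t, so their lengths add up to at most 4 (1 - t), whose integral over [0, 1] is 2.\<close>

lemma nn_integral_add_le_2:
  fixes f g :: "real \<Rightarrow> real"
  assumes [measurable]: "f \<in> borel_measurable borel" "g \<in> borel_measurable borel"
    and nonneg: "\<And>x. 0 \<le> f x" "\<And>x. 0 \<le> g x"
    and supp: "\<And>x. 1 \<le> \<bar>x\<bar> \<Longrightarrow> f x = 0" "\<And>x. 1 \<le> \<bar>x\<bar> \<Longrightarrow> g x = 0"
    and sup: "\<And>t. 0 \<le> t \<Longrightarrow> (\<exists>x. t < f x) \<longleftrightarrow> (\<exists>x. t < g x)"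
    and le: "\<And>x y. \<bar>x\<bar> < 1 \<Longrightarrow> \<bar>y\<bar> < 1 \<Longrightarrow> f x * g y \<le> (1 - \<bar>x + y\<bar> / 2)\<^sup>2"
  shows "(\<integral>\<^sup>+x. ennreal (f x) \<partial>lborel) + (\<integral>\<^sup>+x. ennreal (g x) \<partial>lborel) \<le> 2"
proof -
  have level: "emeasure lborel {x. t < f x} * indicator {0..} t + emeasure lborel {x. t < g x} * indicator {0..} t
      \<le> ennreal (4 * (1 - t)) * indicator {0..1} t" for t
  proof (cases "0 \<le> t \<and> (\<exists>x. t < f x)")
    case False
    then have "t < 0 \<or> {x. t < f x} = {} \<and> {x. t < g x} = {}"
      using sup[of t] by auto
    then show ?thesis
    proof
      assume e: "{x. t < f x} = {} \<and> {x. t < g x} = {}"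
      show ?thesis unfolding e[THEN conjunct1] e[THEN conjunct2] by simp
    qed simp
  next
    case True
    then have t: "0 \<le> t" and ne: "{x. t < f x} \<noteq> {}" "{x. t < g x} \<noteq> {}"
      using sup[of t] by auto
    have bnd: "\<bar>x\<bar> < 1" if "t < f x \<or> t < g x" for x
      using that supp[of x] t by (cases "1 \<le> \<bar>x\<bar>") auto
    have lt: "\<bar>x + y\<bar> < 2 * (1 - t)" if "t < f x" "t < g y" for x y
    proof -
      have "\<bar>x\<bar> < 1" "\<bar>y\<bar> < 1" using bnd that by auto
      then have "\<bar>x + y\<bar> < 1 + 1"
        by (intro le_less_trans[OF abs_triangle_ineq] add_strict_mono)
      then have pos: "0 \<le> 1 - \<bar>x + y\<bar> / 2" by simp
      have "t\<^sup>2 < f x * g y"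
        unfolding power2_eq_square using t that by (intro mult_strict_mono') auto
      also have "\<dots> \<le> (1 - \<bar>x + y\<bar> / 2)\<^sup>2"
        by (rule le) fact+
      finally have "t < 1 - \<bar>x + y\<bar> / 2"
        using pos by (rule power_less_imp_less_base)
      then show ?thesis by simp
    qed
    obtain x y where "t < f x" "t < g y" using ne by auto
    from le_less_trans[OF abs_ge_zero lt[OF this]] have t1: "t \<le> 1" by simp
    have "emeasure lborel {x. t < f x} + emeasure lborel {x. t < g x} \<le> ennreal (2 * (2 * (1 - t)))"
    proof (rule emeasure_midpoint_constraint_le)
      show "{x. t < f x} \<subseteq> {-1..1}" "{x. t < g x} \<subseteq> {-1..1}"
        using bnd by (auto simp: abs_less_iff less_imp_le)
    qed (use ne lt in \<open>auto intro: less_imp_le\<close>)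
    with t t1 show ?thesis by simp
  qed
  have "(\<integral>\<^sup>+x. ennreal (f x) \<partial>lborel) + (\<integral>\<^sup>+x. ennreal (g x) \<partial>lborel) =
    (\<integral>\<^sup>+t. emeasure lborel {x. t < f x} * indicator {0..} t + emeasure lborel {x. t < g x} * indicator {0..} t \<partial>lborel)"
    by (subst nn_integral_add) (simp_all add: nn_integral_layer_cake nonneg)
  also have "\<dots> \<le> (\<integral>\<^sup>+t. ennreal (4 * (1 - t)) * indicator {0..1} t \<partial>lborel)"
    by (intro nn_integral_mono level)
  also have "\<dots> = ennreal ((4 * 1 - 2 * 1\<^sup>2) - (4 * 0 - 2 * 0\<^sup>2))"
    by (rule nn_integral_FTC_Icc) (auto intro!: derivative_eq_intros)
  finally show ?thesis by simp
qed

lemma ennreal_SUP_mult_le: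
  fixes f g :: "'a \<Rightarrow> ennreal"
  assumes "\<And>x y. f x * g y \<le> c"
  shows "(SUP x. f x) * (SUP y. g y) \<le> c"
proof -
  have "(SUP x. f x) * g y \<le> c" for y
    using assms by (simp add: SUP_mult_right_ennreal SUP_le_iff)
  then show ?thesis by (simp add: SUP_mult_left_ennreal SUP_le_iff)
qed

lemma ennreal_mult_le_1_if_add_le_2:
  fixes x y :: ennreal
  assumes "x + y \<le> 2"
  shows "x * y \<le> 1"
proof -
  have "x < top" "y < top"
    using assms by (auto simp: less_top[symmetric] top_unique)
  then obtain a b where ab: "x = ennreal a" "y = ennreal b" "0 \<le> a" "0 \<le> b"
    by (metis ennreal_cases top.not_eq_extremum)
  with assms have "ennreal (a + b) \<le> ennreal 2" by simp
  then have "a + b \<le> 2" by (subst (asm) ennreal_le_iff) auto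
  then have "(a + b) * (a + b) \<le> 2 * 2" using ab by (intro mult_mono) auto
  then have "a * b \<le> 1"
    using zero_le_power2[of "a - b"] by (simp add: power2_eq_square algebra_simps)
  then show ?thesis
    using ab by (simp flip: ennreal_mult ennreal_1 add: ennreal_leI)
qed

lemma prekopa_leindler_triangle:
  fixes F G :: "real \<Rightarrow> ennreal"
  assumes [measurable]: "F \<in> borel_measurable borel" "G \<in> borel_measurable borel"
    and supp: "\<And>x. 1 \<le> \<bar>x\<bar> \<Longrightarrow> F x = 0" "\<And>x. 1 \<le> \<bar>x\<bar> \<Longrightarrow> G x = 0"
    and le: "\<And>x y. \<bar>x\<bar> < 1 \<Longrightarrow> \<bar>y\<bar> < 1 \<Longrightarrow> F x * G y \<le> ennreal ((1 - \<bar>x + y\<bar> / 2)\<^sup>2)"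
  shows "(\<integral>\<^sup>+x. F x \<partial>lborel) * (\<integral>\<^sup>+x. G x \<partial>lborel) \<le> 1"
proof -
  define SF SG where "SF = (SUP x. F x)" and "SG = (SUP x. G x)"
  have le1: "F x * G y \<le> 1" for x y
  proof (cases "\<bar>x\<bar> < 1 \<and> \<bar>y\<bar> < 1")
    case True
    then have "F x * G y \<le> ennreal ((1 - \<bar>x + y\<bar> / 2)\<^sup>2)" by (intro le) auto
    also have "\<dots> \<le> ennreal 1"
      using True by (intro ennreal_leI) (auto intro!: power_le_one)
    finally show ?thesis by simp
  qed (use supp[of x] supp[of y] in \<open>auto simp: not_less\<close>)
  show ?thesis
  proof (cases "SF = 0 \<or> SG = 0")
    case True
    then have "(\<forall>x. F x = 0) \<or> (\<forall>x. G x = 0)"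
      by (auto simp: SF_def SG_def SUP_eq_iff[of _ 0] bot_ennreal[symmetric] SUP_bot_conv)
    then show ?thesis by auto
  next
    case False
    have prod: "SF * SG \<le> 1"
      unfolding SF_def SG_def by (intro ennreal_SUP_mult_le le1)
    then have "SF \<noteq> top" "SG \<noteq> top"
      using False by (auto simp: ennreal_top_mult ennreal_mult_top top_unique)
    then obtain p q where pq: "SF = ennreal p" "SG = ennreal q" "0 < p" "0 < q"
      using False by (metis ennreal_cases ennreal_eq_0_iff not_le_imp_less)
    define f g where "f x = enn2real (F x)" and "g x = enn2real (G x)" for x
    have F: "F x = ennreal (f x)" and G: "G x = ennreal (g x)" for x
    proof -
      have "F x \<le> SF" "G x \<le> SG" by (auto simp: SF_def SG_def intro: SUP_upper)
      then have "F x < top" "G x < top" using pq by (auto intro: le_less_trans)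
      then show "F x = ennreal (f x)" "G x = ennreal (g x)" by (auto simp: f_def g_def)
    qed
    have [measurable]: "f \<in> borel_measurable borel" "g \<in> borel_measurable borel"
      by (simp_all add: f_def[abs_def] g_def[abs_def])
    have nonneg: "0 \<le> f x" "0 \<le> g x" for x by (simp_all add: f_def g_def)
    \<comment> \<open>Scaling by \<open>r\<close> and 1/\<open>r\<close> makes the two suprema
      equal, as \<open>nn_integral_add_le_2\<close> requires, and leaves the product of the
      integrals unchanged.\<close>
    define r where "r = sqrt (q / p)"
    have r: "0 < r" "r * r = q / p" using pq by (simp_all add: r_def)
    have SUP: "(SUP x. ennreal (f x)) = ennreal p" "(SUP x. ennreal (g x)) = ennreal q"
      using pq by (simp_all add: SF_def SG_def F G)
    have ex: "(\<exists>x. u < f x) \<longleftrightarrow> u < p" "(\<exists>x. u < g x) \<longleftrightarrow> u < q" if "0 \<le> u" for u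
      using less_SUP_iff[of "ennreal u" "\<lambda>x. ennreal (f x)" UNIV]
        less_SUP_iff[of "ennreal u" "\<lambda>x. ennreal (g x)" UNIV] that nonneg pq
      by (simp_all add: SUP ennreal_less_iff)
    have eq: "p * r = q / r"
      using r pq by (simp add: field_simps)
    have "(\<integral>\<^sup>+x. ennreal (r * f x) \<partial>lborel) + (\<integral>\<^sup>+x. ennreal (g x / r) \<partial>lborel) \<le> 2"
    proof (rule nn_integral_add_le_2)
      show "(\<exists>x. t < r * f x) \<longleftrightarrow> (\<exists>x. t < g x / r)" if "0 \<le> t" for t
      proof -
        have "(\<exists>x. t < r * f x) \<longleftrightarrow> (\<exists>x. t / r < f x)"
          using r by (simp add: field_simps)
        also have "\<dots> \<longleftrightarrow> t / r < p" using that r by (intro ex) auto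
        also have "\<dots> \<longleftrightarrow> t < q / r" using r by (simp add: field_simps flip: eq)
        also have "\<dots> \<longleftrightarrow> t * r < q" using r by (simp add: field_simps)
        also have "\<dots> \<longleftrightarrow> (\<exists>x. t * r < g x)" using that r by (intro ex[symmetric]) auto
        also have "\<dots> \<longleftrightarrow> (\<exists>x. t < g x / r)" using r by (simp add: field_simps)
        finally show ?thesis .
      qed
      show "r * f x * (g y / r) \<le> (1 - \<bar>x + y\<bar> / 2)\<^sup>2" if "\<bar>x\<bar> < 1" "\<bar>y\<bar> < 1" for x y
        using le[OF that] r nonneg by (simp add: F G flip: ennreal_mult)
      show "r * f x = 0" "g x / r = 0" if "1 \<le> \<bar>x\<bar>" for x
        using supp[OF that] by (auto simp: f_def g_def)
    qed (use r nonneg in auto)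
    then have "(\<integral>\<^sup>+x. ennreal (r * f x) \<partial>lborel) * (\<integral>\<^sup>+x. ennreal (g x / r) \<partial>lborel) \<le> 1"
      by (rule ennreal_mult_le_1_if_add_le_2)
    moreover have "(\<integral>\<^sup>+x. ennreal (r * f x) \<partial>lborel) = ennreal r * (\<integral>\<^sup>+x. F x \<partial>lborel)"
      using r nonneg by (simp add: F ennreal_mult nn_integral_cmult)
    moreover have "(\<integral>\<^sup>+x. ennreal (g x / r) \<partial>lborel) = ennreal (1 / r) * (\<integral>\<^sup>+x. G x \<partial>lborel)"
      using r nonneg by (simp add: G divide_inverse mult.commute[of "g _"] ennreal_mult nn_integral_cmult)
    moreover have "ennreal r * ennreal (1 / r) = 1"
      using r by (simp flip: ennreal_mult)
    then have "ennreal r * (\<integral>\<^sup>+x. F x \<partial>lborel) * (ennreal (1 / r) * (\<integral>\<^sup>+x. G x \<partial>lborel)) =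
        (\<integral>\<^sup>+x. F x \<partial>lborel) * (\<integral>\<^sup>+x. G x \<partial>lborel)"
      by (metis (no_types, lifting) mult.assoc mult.left_commute mult_1)
    ultimately show ?thesis by simp
  qed
qed

definition triangular :: "real measure" where
  "triangular = density lborel (\<lambda>x. ennreal (1 - \<bar>x\<bar>))"

lemma sets_triangular[measurable_cong, simp]: "sets triangular = sets borel"
  and space_triangular[simp]: "space triangular = UNIV"
  by (simp_all add: triangular_def)

lemma nn_integral_triangular:
  "f \<in> borel_measurable borel \<Longrightarrow>
    (\<integral>\<^sup>+x. f x \<partial>triangular) = (\<integral>\<^sup>+x. ennreal (1 - \<bar>x\<bar>) * f x \<partial>lborel)"
  by (simp add: triangular_def nn_integral_density)

lemma tau_kernel_triangular:
  assumes k: "\<And>x y. \<bar>x\<bar> < 1 \<Longrightarrow> \<bar>y\<bar> < 1 \<Longrightarrow>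
      k x y \<le> ennreal ((1 - \<bar>x + y\<bar> / 2)\<^sup>2 / ((1 - \<bar>x\<bar>) * (1 - \<bar>y\<bar>)))"
  shows "tau_kernel triangular k"
proof (rule tau_kernelI)
  fix a b :: "real \<Rightarrow> ennreal"
  assume "a \<in> borel_measurable triangular" "b \<in> borel_measurable triangular"
  then have [measurable]: "a \<in> borel_measurable borel" "b \<in> borel_measurable borel"
    by (simp_all cong: measurable_cong_sets)
  assume ab: "\<And>x y. x \<in> space triangular \<Longrightarrow> y \<in> space triangular \<Longrightarrow> a x * b y \<le> k x y"
  have "(\<integral>\<^sup>+x. ennreal (1 - \<bar>x\<bar>) * a x \<partial>lborel) * (\<integral>\<^sup>+x. ennreal (1 - \<bar>x\<bar>) * b x \<partial>lborel) \<le> 1"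
  proof (rule prekopa_leindler_triangle)
    fix x y :: real assume xy: "\<bar>x\<bar> < 1" "\<bar>y\<bar> < 1"
    define p q where "p = 1 - \<bar>x\<bar>" and "q = 1 - \<bar>y\<bar>"
    have pq: "0 < p" "0 < q" using xy by (auto simp: p_def q_def)
    have "ennreal p * a x * (ennreal q * b y) = ennreal (p * q) * (a x * b y)"
      using pq by (simp add: ennreal_mult ac_simps)
    also have "\<dots> \<le> ennreal (p * q) * ennreal ((1 - \<bar>x + y\<bar> / 2)\<^sup>2 / (p * q))"
      using order_trans[OF ab k[OF xy]] by (intro mult_left_mono) (auto simp: p_def q_def)
    also have "\<dots> = ennreal ((1 - \<bar>x + y\<bar> / 2)\<^sup>2)"
      using pq by (simp flip: ennreal_mult)
    finally show "ennreal (1 - \<bar>x\<bar>) * a x * (ennreal (1 - \<bar>y\<bar>) * b y) \<le> ennreal ((1 - \<bar>x + y\<bar> / 2)\<^sup>2)"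
      by (simp add: p_def q_def)
  qed (auto simp: ennreal_neg)
  then show "(\<integral>\<^sup>+x. a x \<partial>triangular) * (\<integral>\<^sup>+x. b x \<partial>triangular) \<le> 1"
    by (simp add: nn_integral_triangular)
qed

section \<open>Symmetric log-concave laws on the line\<close>

text \<open>The one-dimensional argument tests log-concavity on half-lines only, so it is assumed
  for the cdf. This form also covers laws without a density, such as the Dirac measure at 0.\<close>

locale symmetric_log_concave_cdf = real_distribution M for M :: "real measure" +
  assumes sym: "distr M borel uminus = M"
    and log_concave: "\<And>u x y. 0 \<le> u \<Longrightarrow> u \<le> 1 \<Longrightarrow>
      cdf M x powr u * cdf M y powr (1 - u) \<le> cdf M (u * x + (1 - u) * y)"
begin

sublocale cdf_distribution M
  by unfold_locales

lemma measure_reflect: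
  assumes "A \<in> sets borel"
  shows "measure M (uminus -` A) = measure M A"
proof -
  have "measure M A = measure (distr M borel uminus) A" by (simp add: sym)
  also have "\<dots> = measure M (uminus -` A)"
    using assms by (simp add: measure_distr)
  finally show ?thesis ..
qed

lemma measure_atLeast: "measure M {t..} = cdf M (- t)"
proof -
  have "uminus -` {..-t} = {t..}" by auto
  with measure_reflect[of "{..-t}"] show ?thesis by (simp add: cdf_def)
qed

lemma cdf_eq_lessThan: "cdf M x = 1 - measure M {..<- x}"
proof -
  have "uminus -` {..<- x} = {x<..}" by auto
  with measure_reflect[of "{..<- x}"] have "measure M {..<- x} = measure M (UNIV - {..x})"
    by (simp add: Compl_eq_Diff_UNIV[symmetric])
  also have "\<dots> = 1 - cdf M x"
    using prob_compl[of "{..x}"] by (simp add: cdf_def)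
  finally show ?thesis by simp
qed

lemma cdf_add_uminus_ge: "1 \<le> cdf M x + cdf M (- x)"
proof -
  have "measure M {..<- x} \<le> cdf M (- x)"
    unfolding cdf_def by (intro finite_measure_mono) auto
  then show ?thesis using cdf_eq_lessThan[of x] by simp
qed

lemma cdf_0_ge: "1 / 2 \<le> cdf M 0"
  using cdf_add_uminus_ge[of 0] by simp

text \<open>\<open>tail_quantile\<close> is the monotone map from the two-sided exponential law to \<open>M\<close>, restricted to
  the positive half-line.\<close>

definition tail_quantile :: "real \<Rightarrow> real" where
  "tail_quantile s = (if s \<le> 0 then 0 else - Inf {x. exp (- s) / 2 \<le> cdf M x})"

text \<open>The Galois connection between quantile and cdf. Working through it treats jumps and flat
  pieces of the cdf uniformly. It stops at s = 0, below which \<open>tail_quantile\<close> has the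
  default value 0.\<close>

lemma le_tail_quantile_iff:
  assumes "0 < s"
  shows "t \<le> tail_quantile s \<longleftrightarrow> exp (- s) / 2 \<le> cdf M (- t)"
proof -
  have "exp (- s) < 1" using assms by simp
  then have "exp (- s) / 2 < 1" by linarith
  then have "exp (- s) / 2 \<le> cdf M (- t) \<longleftrightarrow> Inf {x. exp (- s) / 2 \<le> cdf M x} \<le> - t"
    by (intro pseudoinverse) simp_all
  then show ?thesis using assms by (auto simp: tail_quantile_def)
qed

lemma cdf_tail_quantile: "0 < s \<Longrightarrow> exp (- s) / 2 \<le> cdf M (- tail_quantile s)"
  using le_tail_quantile_iff[of s "tail_quantile s"] by simp

lemma tail_quantile_eq_0: "s \<le> 0 \<Longrightarrow> tail_quantile s = 0"
  by (simp add: tail_quantile_def)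

lemma tail_quantile_nonneg: "0 \<le> tail_quantile s"
proof (cases "s \<le> 0")
  case False
  have "exp (- s) \<le> 1" using False by simp
  then have "exp (- s) / 2 \<le> cdf M 0" using cdf_0_ge by linarith
  then show ?thesis using False le_tail_quantile_iff[of s 0] by simp
qed (simp add: tail_quantile_eq_0)

lemma mono_tail_quantile: "mono tail_quantile"
proof (rule monoI)
  fix r s :: real assume "r \<le> s"
  show "tail_quantile r \<le> tail_quantile s"
  proof (cases "r \<le> 0")
    case False
    with \<open>r \<le> s\<close> have "exp (- s) / 2 \<le> exp (- r) / 2" by simp
    also have "\<dots> \<le> cdf M (- tail_quantile r)" using False by (intro cdf_tail_quantile) auto
    finally show ?thesis using False \<open>r \<le> s\<close> by (subst le_tail_quantile_iff) auto
  qed (simp add: tail_quantile_eq_0 tail_quantile_nonneg)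
qed

lemma measurable_tail_quantile[measurable]: "tail_quantile \<in> borel_measurable borel"
  by (rule borel_measurable_mono) (rule mono_tail_quantile)

section \<open>Concavity of the tail quantile and its slope at the origin\<close>

text \<open>The weights add up to 1, so the factor 1/2 is reproduced and the exponents combine
  linearly. An exponent may be 0, as at the origin in \<open>tail_quantile_superlinear\<close>, or
  negative, as to the right of it in \<open>tail_quantile_lower\<close>.\<close>

lemma exp_combination_le_cdf:
  assumes u: "0 \<le> u" "u \<le> 1" and x: "exp (- r) / 2 \<le> cdf M x" and y: "exp (- s) / 2 \<le> cdf M y"
  shows "exp (- (u * r + (1 - u) * s)) / 2 \<le> cdf M (u * x + (1 - u) * y)"
proof -
  have e: "(exp (- r) / 2) powr v = exp (- (v * (r + ln 2)))" for r v :: real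
    by (simp add: powr_def ln_div algebra_simps)
  have "exp (- (u * r + (1 - u) * s)) / 2 = exp (- (u * r + (1 - u) * s) - ln 2)"
    by (simp add: exp_diff)
  also have "- (u * r + (1 - u) * s) - ln 2 = - (u * (r + ln 2)) + - ((1 - u) * (s + ln 2))"
    by (simp add: algebra_simps)
  also have "exp \<dots> = (exp (- r) / 2) powr u * (exp (- s) / 2) powr (1 - u)"
    by (simp only: e exp_add)
  also have "\<dots> \<le> cdf M x powr u * cdf M y powr (1 - u)"
    using u by (intro mult_mono powr_mono2 x y) auto
  also have "\<dots> \<le> cdf M (u * x + (1 - u) * y)"
    using u by (rule log_concave)
  finally show ?thesis .
qed

lemma tail_quantile_superlinear:
  assumes "0 \<le> c" "c \<le> 1"
  shows "c * tail_quantile s \<le> tail_quantile (c * s)"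
proof (cases "0 < c * s")
  case True
  then have "0 < s" using assms by (auto simp: zero_less_mult_iff)
  have "exp (- (c * s + (1 - c) * 0)) / 2 \<le> cdf M (c * (- tail_quantile s) + (1 - c) * 0)"
    using cdf_0_ge by (intro exp_combination_le_cdf assms cdf_tail_quantile \<open>0 < s\<close>) auto
  then show ?thesis using True by (subst le_tail_quantile_iff) auto
next
  case False
  then have "c = 0 \<or> s \<le> 0" using assms by (auto simp: not_less mult_le_0_iff)
  then show ?thesis by (auto simp: tail_quantile_eq_0 mult_nonneg_nonpos tail_quantile_nonneg)
qed

lemma tail_quantile_double: "tail_quantile s \<le> 2 * tail_quantile (s / 2)"
  using tail_quantile_superlinear[of "1 / 2" s] by simp

lemma tail_quantile_midpoint:
  assumes "0 \<le> r" "0 \<le> s"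
  shows "tail_quantile r + tail_quantile s \<le> 2 * tail_quantile ((r + s) / 2)"
proof -
  consider "r = 0" | "s = 0" | "0 < r" "0 < s" using assms by fastforce
  then show ?thesis
  proof cases
    case 3
    have "exp (- (1 / 2 * r + (1 - 1 / 2) * s)) / 2 \<le>
        cdf M (1 / 2 * (- tail_quantile r) + (1 - 1 / 2) * (- tail_quantile s))"
      using 3 by (intro exp_combination_le_cdf cdf_tail_quantile) auto
    also have "1 / 2 * (- tail_quantile r) + (1 - 1 / 2) * (- tail_quantile s) =
        - ((tail_quantile r + tail_quantile s) / 2)"
      by (simp add: field_simps)
    also have "1 / 2 * r + (1 - 1 / 2) * s = (r + s) / 2"
      by (simp add: field_simps)
    finally have "(tail_quantile r + tail_quantile s) / 2 \<le> tail_quantile ((r + s) / 2)"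
      using 3 by (subst le_tail_quantile_iff) auto
    then show ?thesis by simp
  qed (use tail_quantile_double in \<open>simp_all add: tail_quantile_eq_0\<close>)
qed

text \<open>Superlinearity at s and at r - s, with r as the common endpoint, makes
  \<open>tail_quantile\<close> subadditive. Doubling then brings the bound to the form of
  \<open>tail_quantile_midpoint\<close>, so equal and opposite signs can be treated alike.\<close>

lemma tail_quantile_diff:
  assumes "0 \<le> s" "s \<le> r"
  shows "tail_quantile r - tail_quantile s \<le> 2 * tail_quantile ((r - s) / 2)"
proof (cases "r = 0")
  case False
  with assms have r: "0 < r" by simp
  have "s / r * tail_quantile r \<le> tail_quantile (s / r * r)"
    using assms r by (intro tail_quantile_superlinear) auto
  moreover have "(r - s) / r * tail_quantile r \<le> tail_quantile ((r - s) / r * r)"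
    using assms r by (intro tail_quantile_superlinear) auto
  moreover have "s / r * tail_quantile r + (r - s) / r * tail_quantile r = tail_quantile r"
    using r by (simp add: field_simps)
  ultimately show ?thesis using r tail_quantile_double[of "r - s"] by simp
qed (use assms tail_quantile_nonneg in simp)

text \<open>An atom at the origin would force \<open>cdf M 0 > 1 / 2\<close>; by log-concavity it can only occur for
  the Dirac measure.\<close>

lemma cdf_0_le:
  assumes "0 < s" "0 < tail_quantile s"
  shows "cdf M 0 \<le> 1 / 2"
proof -
  define t where "t = tail_quantile s"
  have pos: "0 < cdf M (- t)" "0 < cdf M 0"
    using cdf_tail_quantile[OF assms(1)] cdf_0_ge
    by (auto simp: t_def intro: less_le_trans[of 0 "exp (- s) / 2"])
  have "cdf M (- t) powr e * cdf M 0 powr (1 - e) \<le> 1 / 2" if e: "0 < e" "e < 1" for e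
  proof -
    have "cdf M (- t) powr e * cdf M 0 powr (1 - e) \<le> cdf M (e * (- t) + (1 - e) * 0)"
      using e by (intro log_concave) auto
    \<comment> \<open>The points - e t are negative, so an atom at the origin does not enter this
      bound; letting e tend to 0 carries the bound over to \<open>cdf M 0\<close>.\<close>
    also have "\<dots> \<le> measure M {..<0}"
      unfolding cdf_def using e assms by (intro finite_measure_mono) (auto simp: t_def mult_pos_pos intro: le_less_trans)
    also have "\<dots> = 1 - cdf M 0" using cdf_eq_lessThan[of 0] by simp
    also have "\<dots> \<le> 1 / 2" using cdf_0_ge by simp
    finally show ?thesis .
  qed
  then have "\<forall>\<^sub>F e in at_right 0. cdf M (- t) powr e * cdf M 0 powr (1 - e) \<le> 1 / 2"
    by (auto simp: eventually_at_right[of 0 1] intro!: exI[of _ 1])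
  moreover have "((\<lambda>e. cdf M (- t) powr e * cdf M 0 powr (1 - e)) \<longlongrightarrow>
      cdf M (- t) powr 0 * cdf M 0 powr (1 - 0)) (at_right 0)"
    using pos by (intro tendsto_intros) auto
  ultimately have "cdf M (- t) powr 0 * cdf M 0 powr (1 - 0) \<le> 1 / 2"
    by (intro tendsto_upperbound) auto
  then show ?thesis using pos by simp
qed

text \<open>Log-concavity between the points \<open>- tail_quantile s\<close> and \<open>r > tail_quantile u\<close>, evaluated
  at the origin.\<close>

lemma tail_quantile_lower:
  assumes s: "0 < s" and u: "0 < u"
  shows "tail_quantile s / s * ln 2 * (1 - exp (- u)) \<le> tail_quantile u"
proof (cases "tail_quantile s = 0")
  case True
  then show ?thesis by (simp add: tail_quantile_nonneg)
next
  case False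
  define t where "t = tail_quantile s"
  have t: "0 < t" using False tail_quantile_nonneg[of s] by (simp add: t_def)
  have u1: "0 < 1 - exp (- u)" using u by simp
  show ?thesis
  proof (rule dense_ge)
    fix r assume r: "tail_quantile u < r"
    then have r0: "0 < r" using tail_quantile_nonneg[of u] by linarith
    have "\<not> exp (- u) / 2 \<le> cdf M (- r)"
      using r le_tail_quantile_iff[OF u, of r] by (metis not_le)
    then have F: "1 - exp (- u) / 2 \<le> cdf M r"
      using cdf_add_uminus_ge[of r] by linarith
    \<comment> \<open>The exponent of the point r on the exponential scale. It is negative, because
      the cdf there is at least 1 - exp (- u)/2, which exceeds 1/2.\<close>
    define w where "w = - ln (2 * (1 - exp (- u) / 2))"
    have "0 < 2 - exp (- u)" using u1 by linarith
    then have "exp (- w) = 2 - exp (- u)" by (simp add: w_def)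
    then have "exp (- w) / 2 \<le> cdf M r" using F by simp
    moreover have "exp (- s) / 2 \<le> cdf M (- t)"
      unfolding t_def using s by (rule cdf_tail_quantile)
    ultimately have "exp (- (t / (t + r) * w + (1 - t / (t + r)) * s)) / 2 \<le>
        cdf M (t / (t + r) * r + (1 - t / (t + r)) * (- t))"
      using t r0 by (intro exp_combination_le_cdf) auto
    also have "t / (t + r) * r + (1 - t / (t + r)) * (- t) = 0"
      using t r0 by (simp add: field_simps)
    also have "cdf M 0 \<le> 1 / 2"
      using cdf_0_le[OF s] t by (simp add: t_def)
    finally have "0 \<le> t / (t + r) * w + (1 - t / (t + r)) * s" by simp
    also have "1 - t / (t + r) = r / (t + r)"
      using t r0 by (simp add: field_simps)
    also have "t / (t + r) * w + r / (t + r) * s = (t * w + r * s) / (t + r)"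
      by (simp add: add_divide_distrib)
    finally have "0 \<le> t * w + r * s" using t r0 by (simp add: zero_le_divide_iff)
    moreover have "(1 - exp (- u)) * ln 2 \<le> ln (1 + (1 - exp (- u)))"
      using u1 by (intro mult_ln_2_le_ln_1_plus) auto
    then have "(1 - exp (- u)) * ln 2 \<le> - w"
      by (simp add: w_def algebra_simps)
    then have "t * ((1 - exp (- u)) * ln 2) \<le> t * - w"
      using t by (intro mult_left_mono) auto
    ultimately have "t * ((1 - exp (- u)) * ln 2) \<le> r * s" by simp
    then show "tail_quantile s / s * ln 2 * (1 - exp (- u)) \<le> r"
      using s by (simp add: t_def field_simps)
  qed
qed

text \<open>The substitution \<open>\<bar>\<xi>\<bar> = 1 - exp (- \<bar>x\<bar> / 2)\<close> turns the two-sided exponential law into the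
  triangular one. Only one of the two terms below is nonzero for \<open>\<bar>\<xi>\<bar> < 1\<close>, since
  \<open>tail_quantile\<close> vanishes on nonpositive arguments.\<close>

definition transport :: "real \<Rightarrow> real" where
  "transport \<xi> = tail_quantile (- 2 * ln (1 - \<xi>)) - tail_quantile (- 2 * ln (1 + \<xi>))"

lemma measurable_transport[measurable]: "transport \<in> borel_measurable borel"
  unfolding transport_def[abs_def] by measurable

lemma transport_uminus: "transport (- \<xi>) = - transport \<xi>"
  by (simp add: transport_def)

lemma transport_nonneg_eq: "0 \<le> \<xi> \<Longrightarrow> transport \<xi> = tail_quantile (- 2 * ln (1 - \<xi>))"
  by (simp add: transport_def tail_quantile_eq_0)

text \<open>With p = 1 - |\<xi>| and q = 1 - |\<eta>|, the exponential coordinates have absolute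
  values -2 ln p and -2 ln q, and s is half their distance. For equal signs the squared cosh is
  exactly the kernel; for opposite signs the comparison reduces to |p - q| <= 1 - p q.\<close>

lemma transport_diff:
  assumes "\<bar>\<xi>\<bar> < 1" "\<bar>\<eta>\<bar> < 1"
  obtains s where "0 \<le> s" "\<bar>transport \<xi> - transport \<eta>\<bar> \<le> 2 * tail_quantile s"
    "(cosh (s / 2))\<^sup>2 \<le> (1 - \<bar>\<xi> + \<eta>\<bar> / 2)\<^sup>2 / ((1 - \<bar>\<xi>\<bar>) * (1 - \<bar>\<eta>\<bar>))"
proof -
  let ?P = "\<lambda>\<xi> \<eta>. \<exists>s\<ge>0. \<bar>transport \<xi> - transport \<eta>\<bar> \<le> 2 * tail_quantile s \<and>
    (cosh (s / 2))\<^sup>2 \<le> (1 - \<bar>\<xi> + \<eta>\<bar> / 2)\<^sup>2 / ((1 - \<bar>\<xi>\<bar>) * (1 - \<bar>\<eta>\<bar>))"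
  have same: "?P \<xi> \<eta>" if "0 \<le> \<eta>" "\<eta> \<le> \<xi>" "\<xi> < 1" for \<xi> \<eta>
  proof -
    define p q where "p = 1 - \<xi>" and "q = 1 - \<eta>"
    have pq: "0 < p" "p \<le> q" "q \<le> 1" using that by (auto simp: p_def q_def)
    have ln: "ln p \<le> ln q" "ln q \<le> 0" using pq by auto
    have "transport \<xi> - transport \<eta> = tail_quantile (- 2 * ln p) - tail_quantile (- 2 * ln q)"
      using that by (simp add: transport_nonneg_eq p_def q_def)
    moreover have "tail_quantile (- 2 * ln p) - tail_quantile (- 2 * ln q) \<le>
        2 * tail_quantile ((- 2 * ln p - (- 2 * ln q)) / 2)"
      using ln by (intro tail_quantile_diff) auto
    moreover have "tail_quantile (- 2 * ln q) \<le> tail_quantile (- 2 * ln p)"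
      using ln by (intro monoD[OF mono_tail_quantile]) auto
    moreover have "(- 2 * ln p - (- 2 * ln q)) / 2 = ln (q / p)"
      using pq by (simp add: ln_div)
    ultimately have "\<bar>transport \<xi> - transport \<eta>\<bar> \<le> 2 * tail_quantile (ln (q / p))" by simp
    moreover have "(cosh (ln (q / p) / 2))\<^sup>2 = ((p + q) / 2)\<^sup>2 / (p * q)"
      using pq by (subst cosh_half_ln_power2) (auto simp: field_simps power2_eq_square)
    moreover have "1 - \<bar>\<xi> + \<eta>\<bar> / 2 = (p + q) / 2" "1 - \<bar>\<xi>\<bar> = p" "1 - \<bar>\<eta>\<bar> = q"
      using that by (auto simp: p_def q_def field_simps)
    moreover have "0 \<le> ln (q / p)" using pq by simp
    ultimately show ?thesis by (intro exI[of _ "ln (q / p)"]) (simp only: order_refl simp_thms)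
  qed
  have opp: "?P \<xi> \<eta>" if "\<eta> \<le> 0" "0 \<le> \<xi>" "\<xi> < 1" "- 1 < \<eta>" for \<xi> \<eta>
  proof -
    define p q where "p = 1 - \<xi>" and "q = 1 + \<eta>"
    have pq: "0 < p" "0 < q" "p \<le> 1" "q \<le> 1" using that by (auto simp: p_def q_def)
    have ln: "ln p \<le> 0" "ln q \<le> 0" using pq by auto
    have "transport \<eta> = - tail_quantile (- 2 * ln q)"
      using that transport_nonneg_eq[of "- \<eta>"] by (simp add: transport_uminus q_def)
    then have "transport \<xi> - transport \<eta> = tail_quantile (- 2 * ln p) + tail_quantile (- 2 * ln q)"
      using that by (simp add: transport_nonneg_eq p_def)
    moreover have "tail_quantile (- 2 * ln p) + tail_quantile (- 2 * ln q) \<le>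
        2 * tail_quantile ((- 2 * ln p + - 2 * ln q) / 2)"
      using ln by (intro tail_quantile_midpoint) auto
    moreover have "(- 2 * ln p + - 2 * ln q) / 2 = ln (1 / (p * q))"
      using pq by (simp add: ln_div ln_mult)
    ultimately have 1: "\<bar>transport \<xi> - transport \<eta>\<bar> \<le> 2 * tail_quantile (ln (1 / (p * q)))"
      using tail_quantile_nonneg by simp
    have "0 \<le> (1 - p) * (1 + q)" "0 \<le> (1 - q) * (1 + p)"
      using pq by (auto intro!: mult_nonneg_nonneg)
    then have "(1 + p * q) / 2 \<le> 1 - \<bar>p - q\<bar> / 2"
      by (auto simp: abs_if field_simps)
    also have "\<bar>p - q\<bar> = \<bar>\<xi> + \<eta>\<bar>" by (simp add: p_def q_def abs_minus_commute)
    finally have 2: "((1 + p * q) / 2)\<^sup>2 / (p * q) \<le> (1 - \<bar>\<xi> + \<eta>\<bar> / 2)\<^sup>2 / (p * q)"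
      using pq by (intro divide_right_mono power_mono) auto
    have "(cosh (ln (1 / (p * q)) / 2))\<^sup>2 = ((1 + p * q) / 2)\<^sup>2 / (p * q)"
      using pq by (subst cosh_half_ln_power2) (auto simp: field_simps power2_eq_square)
    moreover have "1 - \<bar>\<xi>\<bar> = p" "1 - \<bar>\<eta>\<bar> = q"
      using that by (auto simp: p_def q_def field_simps)
    moreover have "p * q \<le> 1" using pq by (intro mult_le_one) auto
    then have "0 \<le> ln (1 / (p * q))" using pq by simp
    ultimately show ?thesis using 1 2 by (intro exI[of _ "ln (1 / (p * q))"]) auto
  qed
  have swap: "?P \<eta> \<xi>" if "?P \<xi> \<eta>" for \<xi> \<eta>
    using that by (simp only: abs_minus_commute[of "transport \<eta>"] add.commute[of \<eta>] mult.commute[of "1 - \<bar>\<eta>\<bar>"])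
  have neg: "?P \<xi> \<eta>" if "?P (- \<xi>) (- \<eta>)" for \<xi> \<eta>
  proof -
    have "\<bar>- \<xi> + - \<eta>\<bar> = \<bar>\<xi> + \<eta>\<bar>" "\<bar>- transport \<xi> - - transport \<eta>\<bar> = \<bar>transport \<xi> - transport \<eta>\<bar>"
      by auto
    with that show ?thesis unfolding transport_uminus abs_minus_cancel by (simp only:)
  qed
  have "?P \<xi> \<eta>"
  proof (cases "0 \<le> \<xi>"; cases "0 \<le> \<eta>")
    assume "0 \<le> \<xi>" "0 \<le> \<eta>"
    then show ?thesis using same[of \<eta> \<xi>] swap[OF same[of \<xi> \<eta>]] assms by (cases "\<xi> \<le> \<eta>") auto
  next
    assume "0 \<le> \<xi>" "\<not> 0 \<le> \<eta>"
    then show ?thesis using assms by (intro opp) auto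
  next
    assume "\<not> 0 \<le> \<xi>" "0 \<le> \<eta>"
    then show ?thesis using assms by (intro swap[OF opp]) auto
  next
    assume "\<not> 0 \<le> \<xi>" "\<not> 0 \<le> \<eta>"
    then show ?thesis
      using neg[OF same[of "- \<eta>" "- \<xi>"]] neg[OF swap[OF same[of "- \<xi>" "- \<eta>"]]] assms
      by (cases "\<xi> \<le> \<eta>") auto
  qed
  then show ?thesis using that by blast
qed

end

section \<open>Integrals against the triangular law, and uniqueness of symmetric laws\<close>

lemma emeasure_triangular_left:
  fixes z :: real
  assumes "- 1 \<le> z" "z \<le> 0"
  shows "emeasure triangular {..z} = ennreal ((1 + z)\<^sup>2 / 2)"
proof -
  have "emeasure triangular {..z} = (\<integral>\<^sup>+x. ennreal (1 + x) * indicator {-1..z} x \<partial>lborel)"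
    unfolding triangular_def using assms
    by (subst emeasure_density) (auto simp: indicator_def ennreal_neg intro!: nn_integral_cong)
  also have "\<dots> = ennreal ((1 + z)\<^sup>2 / 2 - (1 + (- 1))\<^sup>2 / 2)"
    using assms by (intro nn_integral_FTC_Icc) (auto intro!: derivative_eq_intros)
  finally show ?thesis by simp
qed

text \<open>\<open>F\<close> is a primitive of \<open>f\<close> weighted by the triangular density,
  so each half of [-1, 1] contributes at least F 1 - F 0. The points 0, 1 and -1 are null.\<close>

lemma nn_integral_triangular_even_ge:
  fixes f F :: "real \<Rightarrow> real" and g :: "real \<Rightarrow> ennreal"
  assumes [measurable]: "f \<in> borel_measurable borel" "g \<in> borel_measurable borel"
    and F: "\<And>x. 0 \<le> x \<Longrightarrow> x \<le> 1 \<Longrightarrow> (F has_real_derivative (1 - x) * f x) (at x)"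
    and f: "\<And>x. 0 \<le> x \<Longrightarrow> x \<le> 1 \<Longrightarrow> 0 \<le> f x"
    and le: "\<And>x. 0 < x \<Longrightarrow> x < 1 \<Longrightarrow> ennreal (f x) \<le> g x" "\<And>x. 0 < x \<Longrightarrow> x < 1 \<Longrightarrow> ennreal (f x) \<le> g (- x)"
  shows "ennreal (2 * (F 1 - F 0)) \<le> (\<integral>\<^sup>+x. g x \<partial>triangular)"
proof -
  have nonneg: "0 \<le> (1 - x) * f x" if "0 \<le> x" "x \<le> 1" for x
    using f[OF that] that by simp
  have le_F: "F 0 \<le> F 1"
    using F nonneg by (intro DERIV_nonneg_imp_nondecreasing[of 0 1 F]) auto
  have 1: "(\<integral>\<^sup>+x. ennreal ((1 - x) * f x) * indicator {0..1} x \<partial>lborel) = ennreal (F 1 - F 0)"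
    using F nonneg by (intro nn_integral_FTC_Icc) auto
  have 2: "(\<integral>\<^sup>+x. ennreal ((1 - (- x)) * f (- x)) * indicator {0..1} (- x) \<partial>lborel) = ennreal (F 1 - F 0)"
    using nn_integral_real_affine[of "\<lambda>x. ennreal ((1 - x) * f x) * indicator {0..1} x" "- 1" 0] 1
    by simp
  have "ennreal (2 * (F 1 - F 0)) = ennreal (F 1 - F 0) + ennreal (F 1 - F 0)"
    using le_F by (simp flip: ennreal_plus)
  also have "\<dots> = (\<integral>\<^sup>+x. ennreal ((1 - x) * f x) * indicator {0..1} x +
      ennreal ((1 - (- x)) * f (- x)) * indicator {0..1} (- x) \<partial>lborel)"
    by (subst nn_integral_add) (simp_all only: 1 2, measurable)
  also have "\<dots> \<le> (\<integral>\<^sup>+x. ennreal (1 - \<bar>x\<bar>) * g x \<partial>lborel)"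
  proof (rule nn_integral_mono_AE)
    have "AE x in lborel. x \<noteq> (0::real)" "AE x in lborel. x \<noteq> (1::real)" "AE x in lborel. x \<noteq> (- 1::real)"
      by (rule AE_lborel_singleton)+
    then show "AE x in lborel. ennreal ((1 - x) * f x) * indicator {0..1} x +
      ennreal ((1 - (- x)) * f (- x)) * indicator {0..1} (- x) \<le> ennreal (1 - \<bar>x\<bar>) * g x"
    proof eventually_elim
      fix x :: real assume x: "x \<noteq> 0" "x \<noteq> 1" "x \<noteq> - 1"
      consider "0 < x" "x < 1" | "- 1 < x" "x < 0" | "1 < \<bar>x\<bar>" using x by linarith
      then show "ennreal ((1 - x) * f x) * indicator {0..1} x +
          ennreal ((1 - (- x)) * f (- x)) * indicator {0..1} (- x) \<le> ennreal (1 - \<bar>x\<bar>) * g x"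
      proof cases
        case 1
        with f[of x] le(1)[of x] show ?thesis
          by (auto simp: ennreal_mult intro!: mult_left_mono)
      next
        case 2
        with f[of "- x"] le(2)[of "- x"] show ?thesis
          using ennreal_mult[of "1 + x" "f (- x)"] by (auto intro!: mult_left_mono)
      next
        case 3
        then have "x \<notin> {0..1}" "- x \<notin> {0..1}" by auto
        then show ?thesis by simp
      qed
    qed
  qed
  also have "\<dots> = (\<integral>\<^sup>+x. g x \<partial>triangular)" by (simp add: nn_integral_triangular)
  finally show ?thesis .
qed

interpretation triangular: prob_space triangular
proof
  have "emeasure triangular (space triangular) = (\<integral>\<^sup>+x. 1 \<partial>triangular)" by simp
  also have "\<dots> = (\<integral>\<^sup>+x. ennreal (1 + x) * indicator {-1..0} x + ennreal (1 - x) * indicator {0..1} x \<partial>lborel)"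
    unfolding nn_integral_triangular[OF borel_measurable_const]
  proof (rule nn_integral_cong_AE)
    show "AE x in lborel. ennreal (1 - \<bar>x\<bar>) * 1 =
        ennreal (1 + x) * indicator {-1..0} x + ennreal (1 - x) * indicator {0..1} x"
      using AE_lborel_singleton[of "0::real"]
      by eventually_elim (auto simp: indicator_def ennreal_neg)
  qed
  also have "\<dots> = (\<integral>\<^sup>+x. ennreal (1 + x) * indicator {-1..0} x \<partial>lborel) +
      (\<integral>\<^sup>+x. ennreal (1 - x) * indicator {0..1} x \<partial>lborel)"
    by (rule nn_integral_add) measurable
  also have "(\<integral>\<^sup>+x. ennreal (1 + x) * indicator {-1..0} x \<partial>lborel) =
      ennreal ((1 + 0)\<^sup>2 / 2 - (1 + (- 1))\<^sup>2 / 2)"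
    by (rule nn_integral_FTC_Icc) (auto intro!: derivative_eq_intros)
  also have "(\<integral>\<^sup>+x. ennreal (1 - x) * indicator {0..1} x \<partial>lborel) =
      ennreal (- (1 - 1)\<^sup>2 / 2 - (- (1 - 0)\<^sup>2 / 2))"
    by (rule nn_integral_FTC_Icc) (auto intro!: derivative_eq_intros simp: field_simps)
  also have "ennreal ((1 + 0)\<^sup>2 / 2 - (1 + (- 1))\<^sup>2 / 2) + ennreal (- (1 - 1)\<^sup>2 / 2 - (- (1 - 0)\<^sup>2 / 2)) =
      ennreal ((1 + 0)\<^sup>2 / 2 - (1 + (- 1))\<^sup>2 / 2 + (- (1 - 1)\<^sup>2 / 2 - (- (1 - 0)\<^sup>2 / 2)))"
    by (rule ennreal_plus[symmetric]) auto
  finally show "emeasure triangular (space triangular) = 1" by simp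
qed

lemma nn_integral_triangular_reflect:
  assumes [measurable]: "f \<in> borel_measurable borel"
  shows "(\<integral>\<^sup>+x. f (- x) \<partial>triangular) = (\<integral>\<^sup>+x. f x \<partial>triangular)"
  using nn_integral_real_affine[of "\<lambda>x. ennreal (1 - \<bar>x\<bar>) * f x" "- 1" 0]
  by (simp add: nn_integral_triangular)

lemma distr_triangular_uminus: "distr triangular borel uminus = triangular"
proof (rule measure_eqI)
  fix A assume "A \<in> sets (distr triangular borel uminus)"
  then have [measurable]: "A \<in> sets borel" by simp
  have "emeasure (distr triangular borel uminus) A = (\<integral>\<^sup>+x. indicator A x \<partial>distr triangular borel uminus)"
    by simp
  also have "\<dots> = (\<integral>\<^sup>+x. indicator A (- x) \<partial>triangular)"
    by (rule nn_integral_distr) measurable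
  also have "\<dots> = (\<integral>\<^sup>+x. indicator A x \<partial>triangular)"
    by (rule nn_integral_triangular_reflect) measurable
  finally show "emeasure (distr triangular borel uminus) A = emeasure triangular A" by simp
qed simp

text \<open>By symmetry the cdf at x >= 0 is 1 minus its left limit at - x, and left limits at
  points up to 0 see negative arguments only.\<close>

lemma symmetric_distribution_unique:
  assumes "real_distribution M" "real_distribution N"
    and symM: "distr M borel uminus = M" and symN: "distr N borel uminus = N"
    and eq: "\<And>x. x < 0 \<Longrightarrow> cdf M x = cdf N x"
  shows "M = N"
proof (rule cdf_unique)
  interpret M: real_distribution M by fact
  interpret N: real_distribution N by fact
  have refl: "cdf P x = 1 - measure P {..<- x}"
    if "real_distribution P" "distr P borel uminus = P" for P x
  proof -
    interpret P: real_distribution P by fact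
    have "measure P {..<- x} = measure (distr P borel uminus) {..<- x}" using that by simp
    also have "\<dots> = measure P (UNIV - {..x})"
      by (subst measure_distr) (auto intro!: arg_cong[where f = "measure P"])
    also have "\<dots> = 1 - cdf P x"
      using P.prob_compl[of "{..x}"] by (simp add: cdf_def)
    finally show ?thesis by simp
  qed
  show "cdf M = cdf N"
  proof
    fix x
    show "cdf M x = cdf N x"
    proof (cases "x < 0")
      case False
      have "(cdf M \<longlongrightarrow> measure N {..<- x}) (at_left (- x))"
      proof (rule Lim_transform_eventually[OF N.cdf_at_left])
        show "\<forall>\<^sub>F y in at_left (- x). cdf N y = cdf M y"
          using False eq by (auto simp: eventually_at_left[of "- x - 1"] intro!: exI[of _ "- x - 1"])
      qed
      with M.cdf_at_left have "measure M {..<- x} = measure N {..<- x}"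
        by (rule tendsto_unique[rotated]) simp
      then show ?thesis using assms by (simp add: refl)
    qed (rule eq)
  qed
qed fact+

section \<open>Transport of the triangular law onto \<open>M\<close>, and bounds for the moment
  generating function\<close>

context symmetric_log_concave_cdf
begin

lemma distr_transport: "distr triangular borel transport = M"
proof (rule symmetric_distribution_unique)
  show "real_distribution (distr triangular borel transport)"
    by (rule triangular.real_distribution_distr) measurable
  show "real_distribution M" by unfold_locales
  have "distr (distr triangular borel transport) borel uminus = distr (distr triangular borel uminus) borel transport"
    by (simp add: distr_distr comp_def transport_uminus)
  then show "distr (distr triangular borel transport) borel uminus = distr triangular borel transport"
    by (simp add: distr_triangular_uminus)
  show "distr M borel uminus = M" by (rule sym)
  fix x :: real assume x: "x < 0"
  define c where "c = cdf M x"
  have "c \<le> measure M {..<0}"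
    unfolding c_def cdf_def using x by (intro finite_measure_mono) auto
  also have "\<dots> \<le> 1 / 2" using cdf_eq_lessThan[of 0] cdf_0_ge by simp
  finally have c: "0 \<le> c" "2 * c \<le> 1" by (auto simp: c_def cdf_nonneg)
  \<comment> \<open>The threshold z solves (1 + z)^2/2 = c, the formula of
    \<open>emeasure_triangular_left\<close>. At \<xi> = 0 the equivalence fails when c = 1/2: the
    right side holds, while \<open>transport 0 = 0\<close> exceeds x.\<close>
  have iff: "transport \<xi> \<le> x \<longleftrightarrow> \<xi> \<le> sqrt (2 * c) - 1" if \<xi>: "\<bar>\<xi>\<bar> < 1" "\<xi> \<noteq> 0" for \<xi>
  proof (cases "\<xi> < 0")
    case True
    have "ln (1 + \<xi>) < 0" using True \<xi> by auto
    then have u: "0 < - 2 * ln (1 + \<xi>)" by simp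
    have e: "exp (- (- 2 * ln (1 + \<xi>))) = (1 + \<xi>)\<^sup>2"
      using \<xi> by (simp add: exp_double)
    have "transport \<xi> = - tail_quantile (- 2 * ln (1 + \<xi>))"
      using transport_nonneg_eq[of "- \<xi>"] True by (simp add: transport_uminus)
    then have "transport \<xi> \<le> x \<longleftrightarrow> - x \<le> tail_quantile (- 2 * ln (1 + \<xi>))" by auto
    also have "\<dots> \<longleftrightarrow> (1 + \<xi>)\<^sup>2 / 2 \<le> c"
      unfolding le_tail_quantile_iff[OF u] e by (simp add: c_def)
    also have "\<dots> \<longleftrightarrow> (1 + \<xi>)\<^sup>2 \<le> (sqrt (2 * c))\<^sup>2" using c by auto
    also have "\<dots> \<longleftrightarrow> 1 + \<xi> \<le> sqrt (2 * c)"
      using \<xi> c by (intro power2_le_iff_abs_le[THEN trans]) auto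
    finally show ?thesis by auto
  next
    case False
    then have "0 \<le> transport \<xi>"
      by (simp add: transport_nonneg_eq tail_quantile_nonneg)
    moreover have "sqrt (2 * c) \<le> 1" using c by simp
    ultimately show ?thesis using False x \<xi>(2) by linarith
  qed
  have "emeasure (distr triangular borel transport) {..x} = emeasure triangular {\<xi>. transport \<xi> \<le> x}"
    by (subst emeasure_distr) (auto intro!: arg_cong[where f = "emeasure triangular"])
  also have "\<dots> = emeasure triangular {..sqrt (2 * c) - 1}"
  proof (rule emeasure_eq_AE)
    have "AE \<xi> in lborel. \<xi> \<noteq> (0::real)" by (rule AE_lborel_singleton)
    then have "AE \<xi> in lborel. 0 < ennreal (1 - \<bar>\<xi>\<bar>) \<longrightarrow>
        (\<xi> \<in> {\<xi>. transport \<xi> \<le> x}) = (\<xi> \<in> {..sqrt (2 * c) - 1})"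
      by eventually_elim (auto simp: iff)
    then show "AE \<xi> in triangular. (\<xi> \<in> {\<xi>. transport \<xi> \<le> x}) = (\<xi> \<in> {..sqrt (2 * c) - 1})"
      unfolding triangular_def by (subst AE_density) auto
  qed auto
  also have "\<dots> = ennreal c"
    using c by (subst emeasure_triangular_left) auto
  finally show "cdf (distr triangular borel transport) x = cdf M x"
    using c by (simp add: cdf_def measure_def c_def)
qed

definition mgf :: "real \<Rightarrow> ennreal" where
  "mgf l = (\<integral>\<^sup>+x. ennreal (exp (l * x)) \<partial>M)"

lemma mgf_uminus: "mgf (- l) = mgf l"
proof -
  have "mgf l = (\<integral>\<^sup>+x. ennreal (exp (l * x)) \<partial>distr M borel uminus)" by (simp add: sym mgf_def)
  also have "\<dots> = mgf (- l)" by (simp add: nn_integral_distr mgf_def)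
  finally show ?thesis ..
qed

lemma mgf_eq_cosh: "mgf l = (\<integral>\<^sup>+x. ennreal (cosh (l * x)) \<partial>M)"
proof -
  have "2 * mgf l = mgf l + mgf (- l)" by (simp add: mgf_uminus mult_2)
  also have "\<dots> = (\<integral>\<^sup>+x. ennreal (exp (l * x)) + ennreal (exp (- l * x)) \<partial>M)"
    unfolding mgf_def by (subst nn_integral_add) auto
  also have "\<dots> = (\<integral>\<^sup>+x. 2 * ennreal (cosh (l * x)) \<partial>M)"
  proof (rule nn_integral_cong)
    fix x
    have "ennreal (exp (l * x)) + ennreal (exp (- l * x)) = ennreal (2 * cosh (l * x))"
      by (simp add: cosh_field_def flip: ennreal_plus)
    also have "\<dots> = 2 * ennreal (cosh (l * x))" by (simp add: ennreal_mult)
    finally show "ennreal (exp (l * x)) + ennreal (exp (- l * x)) = 2 * ennreal (cosh (l * x))" .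
  qed
  also have "\<dots> = 2 * (\<integral>\<^sup>+x. ennreal (cosh (l * x)) \<partial>M)" by (simp add: nn_integral_cmult)
  finally show ?thesis by (simp add: ennreal_mult_cancel_left)
qed

lemma mgf_ge_1: "1 \<le> mgf l"
proof -
  have "(\<integral>\<^sup>+x. 1 \<partial>M) \<le> mgf l"
    unfolding mgf_eq_cosh by (intro nn_integral_mono) (simp add: cosh_real_ge_1)
  then show ?thesis using emeasure_space_1 by simp
qed

text \<open>Markov's inequality at the level \<open>tail_quantile s\<close>, beyond which at least
  the mass exp (- s)/2 lies.\<close>

lemma mgf_ge_exp:
  assumes "0 \<le> l" "0 < s"
  shows "ennreal (exp (l * tail_quantile s - s) / 2) \<le> mgf l"
proof -
  define t where "t = tail_quantile s"
  have "ennreal (exp (l * t - s) / 2) = ennreal (exp (l * t)) * ennreal (exp (- s) / 2)"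
    by (simp add: exp_diff exp_minus field_simps flip: ennreal_mult)
  also have "\<dots> \<le> ennreal (exp (l * t)) * ennreal (measure M {t..})"
    using cdf_tail_quantile[OF assms(2)]
    by (intro mult_left_mono ennreal_leI) (auto simp: t_def measure_atLeast)
  also have "\<dots> = (\<integral>\<^sup>+x. ennreal (exp (l * t)) * indicator {t..} x \<partial>M)"
    by (simp add: nn_integral_cmult_indicator emeasure_eq_measure)
  also have "\<dots> \<le> mgf l"
    unfolding mgf_def using assms
    by (intro nn_integral_mono) (auto simp: indicator_def intro!: ennreal_leI mult_left_mono)
  finally show ?thesis by (simp add: t_def)
qed

text \<open>The left side is the moment generating function at l of the uniform law on [-a, a] with
  a = ln 2 T(s)/s. Under the triangular law 1 - (1 - |\<xi>|)^2 is uniform on [0, 1], so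
  \<open>tail_quantile_lower\<close> says that |\<open>transport\<close>| dominates a times a
  uniform variable.\<close>

lemma mgf_ge_sinh:
  assumes s: "0 < s" and l: "0 < l" "0 < tail_quantile s"
  defines "\<kappa> \<equiv> l * (tail_quantile s / s * ln 2)"
  shows "ennreal (sinh \<kappa> / \<kappa>) \<le> mgf l"
proof -
  have \<kappa>: "0 < \<kappa>" using s l by (simp add: \<kappa>_def)
  have pt: "\<kappa> * (1 - (1 - \<xi>)\<^sup>2) \<le> l * transport \<xi>" if "0 < \<xi>" "\<xi> < 1" for \<xi>
  proof -
    have "ln (1 - \<xi>) < 0" using that by simp
    then have u: "0 < - 2 * ln (1 - \<xi>)" by simp
    have "exp (- (- 2 * ln (1 - \<xi>))) = (1 - \<xi>)\<^sup>2" using that by (simp add: exp_double)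
    with tail_quantile_lower[OF s u] have "tail_quantile s / s * ln 2 * (1 - (1 - \<xi>)\<^sup>2) \<le> transport \<xi>"
      using that by (simp add: transport_nonneg_eq)
    then have "l * (tail_quantile s / s * ln 2 * (1 - (1 - \<xi>)\<^sup>2)) \<le> l * transport \<xi>"
      using l by (intro mult_left_mono) auto
    then show ?thesis by (simp add: \<kappa>_def mult.assoc)
  qed
  have cosh_le: "cosh (\<kappa> * (1 - (1 - \<xi>)\<^sup>2)) \<le> cosh (l * transport \<xi>)" if "0 < \<xi>" "\<xi> < 1" for \<xi>
  proof -
    have "0 \<le> \<kappa> * (1 - (1 - \<xi>)\<^sup>2)" using \<kappa> that by (simp add: power_le_one)
    with pt[OF that] show ?thesis by (simp add: cosh_real_nonneg_le_iff)
  qed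
  have "ennreal (2 * (sinh (\<kappa> * (1 - (1 - 1)\<^sup>2)) / (2 * \<kappa>) - sinh (\<kappa> * (1 - (1 - 0)\<^sup>2)) / (2 * \<kappa>))) \<le>
      (\<integral>\<^sup>+\<xi>. ennreal (cosh (l * transport \<xi>)) \<partial>triangular)"
  proof (rule nn_integral_triangular_even_ge[where f = "\<lambda>x. cosh (\<kappa> * (1 - (1 - x)\<^sup>2))"])
    fix x :: real
    show "((\<lambda>x. sinh (\<kappa> * (1 - (1 - x)\<^sup>2)) / (2 * \<kappa>)) has_real_derivative
        (1 - x) * cosh (\<kappa> * (1 - (1 - x)\<^sup>2))) (at x)"
      using \<kappa> by (auto intro!: derivative_eq_intros simp: field_simps)
  qed (use cosh_le in \<open>auto simp: transport_uminus ennreal_leI cosh_real_nonneg\<close>)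
  also have "\<dots> = mgf l"
    unfolding mgf_eq_cosh by (subst (2) distr_transport[symmetric]) (simp add: nn_integral_distr)
  finally show ?thesis using \<kappa> by simp
qed

lemma exp_tail_quantile_le:
  assumes \<beta>: "77 / 10 \<le> \<beta>" and l: "0 \<le> l" and s: "0 \<le> s"
  shows "ennreal (exp (l * tail_quantile s / \<beta>)) \<le> mgf l * ennreal (cosh (s / 2))"
proof (cases "mgf l = top \<or> l * tail_quantile s = 0 \<or> s = 0")
  case True
  \<comment> \<open>In these degenerate cases the right side is infinite, or the exponent on the
    left vanishes and the lower bound 1 is enough.\<close>
  have "1 * 1 \<le> mgf l * ennreal (cosh (s / 2))"
    by (intro mult_mono mgf_ge_1) (auto simp: cosh_real_ge_1)
  with True show ?thesis
    by (auto simp: tail_quantile_eq_0 ennreal_top_mult ennreal_eq_0_iff cosh_real_pos not_le)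
next
  case False
  then have pos: "0 < l" "0 < tail_quantile s" "0 < s"
    using l s tail_quantile_nonneg[of s] by auto
  obtain r where r: "mgf l = ennreal r" "0 \<le> r"
    using False by (cases "mgf l") auto
  have r1: "1 \<le> r" using mgf_ge_1[of l] r by simp
  have "exp (l * tail_quantile s / \<beta>) \<le> r * cosh (s / 2)"
  proof (cases "12 / 5 \<le> s")
    case True
    have "exp (l * tail_quantile s - s) / 2 \<le> r"
      using mgf_ge_exp[OF l pos(3)] r by simp
    then have "ln (exp (l * tail_quantile s - s) / 2) \<le> ln r"
      using r1 by (subst ln_le_cancel_iff) auto
    then have "l * tail_quantile s \<le> ln r + (s + ln 2)" by (simp add: ln_div)
    then have "l * tail_quantile s / \<beta> \<le> ln r / \<beta> + (s + ln 2) / \<beta>"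
      using \<beta> by (simp add: divide_right_mono flip: add_divide_distrib)
    also have "ln r / \<beta> \<le> ln r / 1"
      using \<beta> r1 by (intro divide_left_mono) auto
    finally have "exp (l * tail_quantile s / \<beta>) \<le> exp (ln r + (s + ln 2) / \<beta>)" by simp
    also have "\<dots> = r * exp ((s + ln 2) / \<beta>)" using r1 by (simp add: exp_add)
    also have "\<dots> \<le> r * cosh (s / 2)"
      using r1 True \<beta> by (intro mult_left_mono exp_le_cosh_half_large) auto
    finally show ?thesis .
  next
    case False
    \<comment> \<open>In terms of \<kappa> the exponent is \<kappa> s/(\<beta> ln 2), so \<beta> ln
      2 plays the part of \<open>B\<close> in \<open>exp_mult_le_cosh_sinh\<close>.\<close>
    define \<kappa> where "\<kappa> = l * (tail_quantile s / s * ln 2)"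
    have \<kappa>: "0 < \<kappa>" using pos by (simp add: \<kappa>_def)
    have "5 \<le> 77 / 10 * (2 / 3 :: real)" by simp
    also have "\<dots> \<le> \<beta> * ln 2" using \<beta> ln2_ge_two_thirds by (intro mult_mono) auto
    finally have B: "5 \<le> \<beta> * ln 2" .
    have "l * tail_quantile s / \<beta> = \<kappa> * s / (\<beta> * ln 2)"
      using pos by (simp add: \<kappa>_def field_simps)
    moreover have "\<kappa> * exp (\<kappa> * s / (\<beta> * ln 2)) \<le> cosh (s / 2) * sinh \<kappa>"
      using False s \<kappa> B by (intro exp_mult_le_cosh_sinh) auto
    ultimately have "exp (l * tail_quantile s / \<beta>) \<le> sinh \<kappa> / \<kappa> * cosh (s / 2)"
      using \<kappa> by (simp add: field_simps)
    also have "\<dots> \<le> r * cosh (s / 2)"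
      using mgf_ge_sinh[OF pos(3,1,2)] r
      by (intro mult_right_mono) (auto simp: \<kappa>_def cosh_real_nonneg)
    finally show ?thesis .
  qed
  then show ?thesis using r by (simp add: cosh_real_nonneg flip: ennreal_mult)
qed

text \<open>The kernel is the exponential of the conjugate log-Laplace transform of the
  symmetrization of \<open>M\<close> at (x - y)/\<beta>. Squaring
  \<open>exp_tail_quantile_le\<close> accounts for the factor 2 and the squared cosh in
  \<open>transport_diff\<close>.\<close>

lemma tau_kernel_marginal:
  assumes \<beta>: "77 / 10 \<le> \<beta>"
  shows "tau_kernel M (\<lambda>x y. SUP l. ennreal (exp (l * (x - y) / \<beta>)) / (mgf l * mgf (- l)))"
proof -
  have "tau_kernel triangular (\<lambda>\<xi> \<eta>. SUP l. ennreal (exp (l * (transport \<xi> - transport \<eta>) / \<beta>)) / (mgf l * mgf (- l)))"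
  proof (rule tau_kernel_triangular, rule SUP_least)
    fix \<xi> \<eta> l :: real assume "\<bar>\<xi>\<bar> < 1" "\<bar>\<eta>\<bar> < 1"
    then obtain s where s: "0 \<le> s" "\<bar>transport \<xi> - transport \<eta>\<bar> \<le> 2 * tail_quantile s"
      "(cosh (s / 2))\<^sup>2 \<le> (1 - \<bar>\<xi> + \<eta>\<bar> / 2)\<^sup>2 / ((1 - \<bar>\<xi>\<bar>) * (1 - \<bar>\<eta>\<bar>))" (is "_ \<le> ?K")
      by (rule transport_diff)
    have "l * (transport \<xi> - transport \<eta>) \<le> \<bar>l\<bar> * \<bar>transport \<xi> - transport \<eta>\<bar>"
      by (simp flip: abs_mult)
    also have "\<dots> \<le> \<bar>l\<bar> * (2 * tail_quantile s)" by (intro mult_left_mono s) auto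
    finally have "l * (transport \<xi> - transport \<eta>) / \<beta> \<le> \<bar>l\<bar> * (2 * tail_quantile s) / \<beta>"
      using \<beta> by (intro divide_right_mono) auto
    then have "ennreal (exp (l * (transport \<xi> - transport \<eta>) / \<beta>)) \<le> ennreal (exp (\<bar>l\<bar> * tail_quantile s / \<beta> + \<bar>l\<bar> * tail_quantile s / \<beta>))"
      by (intro ennreal_leI) (simp add: field_simps)
    also have "\<dots> = ennreal (exp (\<bar>l\<bar> * tail_quantile s / \<beta>)) * ennreal (exp (\<bar>l\<bar> * tail_quantile s / \<beta>))"
      by (subst exp_add, subst ennreal_mult) auto
    also have "\<dots> \<le> (mgf \<bar>l\<bar> * ennreal (cosh (s / 2))) * (mgf \<bar>l\<bar> * ennreal (cosh (s / 2)))"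
      using \<beta> s by (intro mult_mono exp_tail_quantile_le) auto
    also have "\<dots> = ennreal ((cosh (s / 2))\<^sup>2) * (mgf l * mgf (- l))"
      by (simp add: mgf_uminus abs_if power2_eq_square ennreal_mult cosh_real_nonneg ac_simps)
    also have "\<dots> \<le> ennreal ?K * (mgf l * mgf (- l))"
      by (intro mult_right_mono ennreal_leI s) auto
    finally have "ennreal (exp (l * (transport \<xi> - transport \<eta>) / \<beta>)) \<le> ennreal ?K * (mgf l * mgf (- l))" .
    moreover have "0 < mgf l * mgf (- l)"
      using mgf_ge_1[of l] mgf_ge_1[of "- l"] by (auto simp: ennreal_zero_less_mult_iff intro: less_le_trans[OF zero_less_one])
    ultimately show "ennreal (exp (l * (transport \<xi> - transport \<eta>) / \<beta>)) / (mgf l * mgf (- l)) \<le> ennreal ?K"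
      by (intro divide_le_posI_ennreal) (auto simp: mult.commute)
  qed
  then have "tau_kernel (distr triangular borel transport) (\<lambda>x y. SUP l. ennreal (exp (l * (x - y) / \<beta>)) / (mgf l * mgf (- l)))"
    by (rule tau_kernel_distr) (auto simp: measurable_cong_sets[OF sets_triangular refl])
  then show ?thesis by (simp add: distr_transport)
qed

end

section \<open>The log-Laplace transform of the symmetric exponential law\<close>

lemma emeasure_lborel_atLeast: "emeasure lborel {a::real..} = \<infinity>"
proof -
  have "(SUP n. of_nat n) \<le> emeasure lborel {a..}"
  proof (rule SUP_least)
    fix n
    have "of_nat n = emeasure lborel {a..a + real n}" by (simp add: ennreal_of_nat_eq_real_of_nat)
    also have "\<dots> \<le> emeasure lborel {a..}" by (intro emeasure_mono) auto
    finally show "of_nat n \<le> emeasure lborel {a..}" .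
  qed
  then show ?thesis by (simp add: ennreal_SUP_of_nat_eq_top top_unique)
qed

lemma nn_integral_exp_atLeast_0:
  fixes c :: real
  assumes "0 < c"
  shows "(\<integral>\<^sup>+x. ennreal (exp (- c * x) / 2) * indicator {0..} x \<partial>lborel) = ennreal (1 / (2 * c))"
proof -
  have "((\<lambda>x. - exp (- c * x) / (2 * c)) \<longlongrightarrow> 0) at_top"
    using assms by real_asymp
  then have "(\<integral>\<^sup>+x. ennreal (exp (- c * x) / 2) * indicator {0..} x \<partial>lborel) =
      ennreal (0 - (- exp (- c * 0) / (2 * c)))"
    using assms by (intro nn_integral_FTC_atLeast) (auto intro!: derivative_eq_intros)
  then show ?thesis by simp
qed

lemma nn_integral_exp_atLeast_0_infinite:
  fixes c :: real
  assumes "c \<le> 0"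
  shows "(\<integral>\<^sup>+x. ennreal (exp (- c * x) / 2) * indicator {0..} x \<partial>lborel) = \<infinity>"
proof -
  have "\<infinity> = (\<integral>\<^sup>+x. ennreal (1 / 2) * indicator {0..} (x::real) \<partial>lborel)"
    by (simp add: nn_integral_cmult emeasure_lborel_atLeast ennreal_mult_top)
  also have "\<dots> \<le> (\<integral>\<^sup>+x. ennreal (exp (- c * x) / 2) * indicator {0..} x \<partial>lborel)"
  proof (rule nn_integral_mono)
    fix x :: real
    have "1 / 2 \<le> exp (- c * x) / 2" if "0 \<le> x"
      using assms that by (simp add: mult_nonpos_nonneg)
    then show "ennreal (1 / 2) * indicator {0..} x \<le> ennreal (exp (- c * x) / 2) * indicator {0..} x"
      by (cases "0 \<le> x") (simp_all only: ennreal_leI mult_right_mono zero_le, simp)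
  qed
  finally show ?thesis by (simp add: top_unique)
qed

text \<open>Kept as two half-line integrals, one of which diverges exactly when |y| >= 1, so that
  the finite and the infinite case share one formula.\<close>

lemma nn_integral_exp_sym_exp:
  "(\<integral>\<^sup>+x. ennreal (exp (x \<bullet> y)) \<partial>sym_exp) =
    (\<integral>\<^sup>+x. ennreal (exp (- (1 - y) * x) / 2) * indicator {0..} x \<partial>lborel) +
    (\<integral>\<^sup>+x. ennreal (exp (- (1 + y) * x) / 2) * indicator {0..} x \<partial>lborel)"
proof -
  have "(\<integral>\<^sup>+x. ennreal (exp (x \<bullet> y)) \<partial>sym_exp) =
      (\<integral>\<^sup>+x. ennreal (exp (- \<bar>x\<bar>) / 2) * ennreal (exp (x * y)) \<partial>lborel)"
    unfolding sym_exp_def by (subst nn_integral_density) simp_all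
  also have "\<dots> = (\<integral>\<^sup>+x. ennreal (exp (- (1 - y) * x) / 2) * indicator {0..} x +
      ennreal (exp (- (1 + y) * (- x)) / 2) * indicator {0..} (- x) \<partial>lborel)"
  proof (rule nn_integral_cong_AE)
    show "AE x in lborel. ennreal (exp (- \<bar>x\<bar>) / 2) * ennreal (exp (x * y)) =
        ennreal (exp (- (1 - y) * x) / 2) * indicator {0..} x +
        ennreal (exp (- (1 + y) * (- x)) / 2) * indicator {0..} (- x)"
      using AE_lborel_singleton[of "0::real"]
    proof eventually_elim
      fix x :: real assume x: "x \<noteq> 0"
      have "ennreal (exp (- \<bar>x\<bar>) / 2) * ennreal (exp (x * y)) = ennreal (exp (- \<bar>x\<bar> + x * y) / 2)"
        by (simp flip: ennreal_mult exp_add)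
      with x show "ennreal (exp (- \<bar>x\<bar>) / 2) * ennreal (exp (x * y)) =
          ennreal (exp (- (1 - y) * x) / 2) * indicator {0..} x +
          ennreal (exp (- (1 + y) * (- x)) / 2) * indicator {0..} (- x)"
        by (cases "0 < x") (auto simp: indicator_def algebra_simps)
    qed
  qed
  also have "\<dots> = (\<integral>\<^sup>+x. ennreal (exp (- (1 - y) * x) / 2) * indicator {0..} x \<partial>lborel) +
      (\<integral>\<^sup>+x. ennreal (exp (- (1 + y) * (- x)) / 2) * indicator {0..} (- x) \<partial>lborel)"
    by (rule nn_integral_add) measurable
  also have "(\<integral>\<^sup>+x. ennreal (exp (- (1 + y) * (- x)) / 2) * indicator {0..} (- x) \<partial>lborel) =
      (\<integral>\<^sup>+x. ennreal (exp (- (1 + y) * x) / 2) * indicator {0..} x \<partial>lborel)"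
    using nn_integral_real_affine[of "\<lambda>x. ennreal (exp (- (1 + y) * x) / 2) * indicator {0..} x" "- 1" 0]
    by simp
  finally show ?thesis .
qed

lemma log_laplace_sym_exp_infinite:
  assumes "1 \<le> \<bar>y\<bar>"
  shows "log_laplace sym_exp y = \<infinity>"
proof -
  have "1 - y \<le> 0 \<or> 1 + y \<le> 0" using assms by linarith
  then have "(\<integral>\<^sup>+x. ennreal (exp (x \<bullet> y)) \<partial>sym_exp) = \<infinity>"
  proof
    assume "1 - y \<le> 0"
    from nn_integral_exp_atLeast_0_infinite[OF this] show ?thesis
      unfolding nn_integral_exp_sym_exp by simp
  next
    assume "1 + y \<le> 0"
    from nn_integral_exp_atLeast_0_infinite[OF this] show ?thesis
      unfolding nn_integral_exp_sym_exp by simp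
  qed
  then show ?thesis by (simp add: log_laplace_def)
qed

text \<open>On this range the transform equals - ln (1 - y^2).\<close>

lemma log_laplace_sym_exp_ge:
  assumes "\<bar>y\<bar> < 1"
  shows "ereal (y\<^sup>2) \<le> log_laplace sym_exp y"
proof -
  have y: "0 < 1 - y" "0 < 1 + y" using assms by linarith+
  have "0 < (1 - y) * (1 + y)" using y by simp
  then have y2: "0 < 1 - y\<^sup>2" by (simp add: power2_eq_square algebra_simps)
  have "(\<integral>\<^sup>+x. ennreal (exp (x \<bullet> y)) \<partial>sym_exp) = ennreal (1 / (2 * (1 - y)) + 1 / (2 * (1 + y)))"
    unfolding nn_integral_exp_sym_exp nn_integral_exp_atLeast_0[OF y(1)] nn_integral_exp_atLeast_0[OF y(2)]
    using y by (intro ennreal_plus[symmetric]) auto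
  also have "1 / (2 * (1 - y)) + 1 / (2 * (1 + y)) = 1 / (1 - y\<^sup>2)"
    using y y2 by (simp add: power2_eq_square field_simps)
  finally have "log_laplace sym_exp y = ereal (ln (1 / (1 - y\<^sup>2)))"
    using y2 by (simp add: log_laplace_def)
  moreover have "ln (1 - y\<^sup>2) \<le> - y\<^sup>2"
    using ln_le_minus_one[OF y2] by simp
  ultimately show ?thesis using y2 by (simp add: ln_div)
qed

text \<open>The supremum of d y - y^2 over |y| < 1 is d - 1, approached at y = 1, if d >= 2;
  otherwise it is d^2/4 <= 1, taken at y = d/2.\<close>

lemma log_laplace_conj_sym_exp_le:
  assumes "0 < d"
  shows "log_laplace_conj sym_exp d \<le> ereal (max 1 (d - 1))"
  unfolding log_laplace_conj_def
proof (rule SUP_least)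
  fix y
  show "ereal (d \<bullet> y) - log_laplace sym_exp y \<le> ereal (max 1 (d - 1))"
  proof (cases "\<bar>y\<bar> < 1")
    case True
    have "d * y - y\<^sup>2 \<le> max 1 (d - 1)"
    proof (cases "2 \<le> d")
      case d2: True
      then have "0 \<le> (1 - y) * (d - 1 - y)" using True by (intro mult_nonneg_nonneg) auto
      then show ?thesis by (simp add: power2_eq_square algebra_simps)
    next
      case False
      have "0 \<le> (y - d / 2)\<^sup>2" by simp
      then have "d * y - y\<^sup>2 \<le> d\<^sup>2 / 4" by (simp add: power2_eq_square algebra_simps)
      also have "d\<^sup>2 \<le> 2\<^sup>2" using False assms by (intro power_mono) auto
      finally show ?thesis by simp
    qed
    have "ereal (d \<bullet> y) - log_laplace sym_exp y \<le> ereal (d * y) - ereal (y\<^sup>2)"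
      using log_laplace_sym_exp_ge[OF True] by (intro ereal_minus_mono) auto
    also have "\<dots> = ereal (d * y - y\<^sup>2)" by simp
    also have "\<dots> \<le> ereal (max 1 (d - 1))"
      unfolding ereal_less_eq(3) by fact
    finally show ?thesis .
  qed (simp add: log_laplace_sym_exp_infinite)
qed

lemma scale_lower_bound:
  assumes "0 < \<delta>" "log_laplace_conj sym_exp \<delta> = ereal (ln 2 + 1 / sqrt 3)"
  shows "77 / 10 \<le> 2 * sqrt 3 * \<delta>"
proof -
  have "(173 / 100)\<^sup>2 \<le> (3::real)" by (simp add: power2_eq_square)
  then have s3: "173 / 100 \<le> sqrt 3" by (rule real_le_rsqrt)
  have "sqrt 3 \<le> sqrt 4" by (subst real_sqrt_le_iff) simp
  also have "sqrt 4 = (2::real)" by simp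
  finally have "1 / 2 \<le> 1 / sqrt 3" using s3 by (intro divide_left_mono) auto
  \<comment> \<open>Exceeding 1 rules out the first entry of the maximum and leaves \<delta> >= 1 +
    ln 2 + 1/sqrt 3. With ln 2 >= 2/3 this yields 10/3 sqrt 3 + 2, slightly more than 7.7.\<close>
  with ln2_ge_two_thirds have "1 < ln 2 + 1 / sqrt 3" by linarith
  moreover have "ln 2 + 1 / sqrt 3 \<le> max 1 (\<delta> - 1)"
    using log_laplace_conj_sym_exp_le[OF assms(1)] assms(2) by (metis ereal_less_eq(3))
  ultimately have "5 / 3 + 1 / sqrt 3 \<le> \<delta>"
    using ln2_ge_two_thirds by (auto simp: max_def split: if_splits)
  then have "2 * sqrt 3 * (5 / 3 + 1 / sqrt 3) \<le> 2 * sqrt 3 * \<delta>"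
    by (intro mult_left_mono) auto
  moreover have "2 * sqrt 3 * (5 / 3 + 1 / sqrt 3) = 10 / 3 * sqrt 3 + 2"
    by (simp add: field_simps)
  ultimately show ?thesis using s3 by linarith
qed

section \<open>Product measures\<close>

text \<open>Log-concavity is given for compact sets, so half-spaces are cut by balls that grow. The
  combination of the cut sets stays inside the half-space at u s + (1 - u) t.\<close>

lemma cdf_marginal_log_concave:
  fixes \<mu> :: "(real ^ 'n) measure" and i :: 'n
  assumes "prob_space \<mu>" and sets[measurable_cong]: "sets \<mu> = sets borel" and lc: "log_concave_measure \<mu>"
    and u: "0 \<le> u" "u \<le> 1"
  defines "F \<equiv> cdf (distr \<mu> borel (\<lambda>x. x $ i))"
  shows "F s powr u * F t powr (1 - u) \<le> F (u * s + (1 - u) * t)"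
proof -
  interpret prob_space \<mu> by fact
  define H where "H = (\<lambda>s n. {x :: real ^ 'n. x $ i \<le> s} \<inter> cball 0 (real n))"
  have F: "F s = measure \<mu> {x. x $ i \<le> s}" for s
    unfolding F_def cdf_def
    by (subst measure_distr) (simp_all add: sets_eq_imp_space_eq[OF sets] vimage_def)
  have compact: "compact (H s n)" for s n
    unfolding H_def by (intro closed_Int_compact closed_Collect_le continuous_intros) auto
  have [measurable]: "H s n \<in> sets borel" for s n
    using compact by (intro borel_closed compact_imp_closed)
  have "s *\<^sub>R axis i 1 \<in> H s n" if "\<bar>s\<bar> \<le> real n" for s n
    using that by (simp add: H_def)
  then have nonempty: "H s n \<noteq> {}" if "\<bar>s\<bar> \<le> real n" for s n
    using that by blast
  have lim: "(\<lambda>n. measure \<mu> (H s n)) \<longlonglongrightarrow> F s" for s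
  proof -
    have "(\<lambda>n. measure \<mu> (H s n)) \<longlonglongrightarrow> measure \<mu> (\<Union>n. H s n)"
      by (intro finite_Lim_measure_incseq) (auto simp: incseq_def H_def)
    also have "(\<Union>n. H s n) = {x. x $ i \<le> s}"
      using real_arch_simple by (auto simp: H_def)
    finally show ?thesis by (simp add: F)
  qed
  have le: "measure \<mu> (H s n) powr u * measure \<mu> (H t n) powr (1 - u) \<le> F (u * s + (1 - u) * t)"
    if "\<bar>s\<bar> \<le> real n" "\<bar>t\<bar> \<le> real n" for n
  proof -
    have "measure \<mu> (H s n) powr u * measure \<mu> (H t n) powr (1 - u) \<le> measure \<mu> (mink_comb u (H s n) (H t n))"
      using lc[unfolded log_concave_measure_def, rule_format, of "H s n" "H t n" u]
        compact nonempty[OF that(1)] nonempty[OF that(2)] u by simp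
    also have "\<dots> \<le> F (u * s + (1 - u) * t)"
    proof -
      have "u * a + (1 - u) * b \<le> u * s + (1 - u) * t" if "a \<le> s" "b \<le> t" for a b
        using u that by (intro add_mono mult_left_mono) auto
      then show ?thesis
        unfolding F by (intro finite_measure_mono subsetI) (auto simp: mink_comb_def H_def)
    qed
    finally show ?thesis .
  qed
  show ?thesis
  \<comment> \<open>The limit of \<open>powr\<close> is taken at nonzero bases; a zero base makes
    the left side 0, whatever the exponent.\<close>
  proof (cases "F s = 0 \<or> F t = 0")
    case True
    then show ?thesis by (auto simp: F)
  next
    case False
    then have "(\<lambda>n. measure \<mu> (H s n) powr u * measure \<mu> (H t n) powr (1 - u)) \<longlonglongrightarrow> F s powr u * F t powr (1 - u)"
      by (intro tendsto_intros lim) auto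
    moreover obtain N where "max \<bar>s\<bar> \<bar>t\<bar> \<le> real N" using real_arch_simple by blast
    then have "\<forall>n\<ge>N. measure \<mu> (H s n) powr u * measure \<mu> (H t n) powr (1 - u) \<le> F (u * s + (1 - u) * t)"
      by (auto intro!: le)
    ultimately show ?thesis by (intro LIMSEQ_le_const2) auto
  qed
qed

section \<open>From kernels back to infimum convolutions and log-Laplace transforms\<close>

lemma eexp_mono: "x \<le> y \<Longrightarrow> eexp x \<le> eexp y"
  by (cases x; cases y) (auto simp: eexp_def)

lemma eexp_add_real: "eexp (z + ereal r) = eexp z * ennreal (exp r)"
  by (cases z) (auto simp: eexp_def exp_add ennreal_mult ennreal_top_mult)

lemma eexp_SUP_le:
  assumes "\<And>i. i \<in> I \<Longrightarrow> eexp (g i) \<le> c" and c: "0 < c"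
  shows "eexp (SUP i\<in>I. g i) \<le> c"
proof (cases c)
  case (real r)
  then have r: "0 < r" using c by simp
  have "g i \<le> ereal (ln r)" if "i \<in> I" for i
    using assms(1)[OF that] real r by (cases "g i") (auto simp: eexp_def top_unique ln_ge_iff)
  then have "eexp (SUP i\<in>I. g i) \<le> eexp (ereal (ln r))"
    by (intro eexp_mono SUP_least)
  then show ?thesis using real r by (simp add: eexp_def)
qed simp

text \<open>For an infinite integral both sides are 0. For a zero integral
  \<open>log_laplace\<close> would take the default value \<open>ln 0 = 0\<close> instead of minus
  infinity.\<close>

lemma eexp_diff_log_laplace:
  assumes "(\<integral>\<^sup>+x. ennreal (exp (x \<bullet> y)) \<partial>M) \<noteq> 0"
  shows "eexp (ereal a - log_laplace M y) = ennreal (exp a) / (\<integral>\<^sup>+x. ennreal (exp (x \<bullet> y)) \<partial>M)"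
proof (cases "\<integral>\<^sup>+x. ennreal (exp (x \<bullet> y)) \<partial>M")
  case (real r)
  then show ?thesis using assms
    by (simp add: log_laplace_def eexp_def exp_diff divide_ennreal)
qed (simp add: log_laplace_def eexp_def)

text \<open>The infimum convolution need not be measurable; its integral is the supremum of the integrals
  of the simple functions below it.\<close>

lemma property_tau_if_tau_kernel:
  fixes M :: "'a::euclidean_space measure"
  assumes sets[measurable_cong]: "sets M = sets borel" and k: "tau_kernel M k"
    and le: "\<And>x y. eexp (W (x - y)) \<le> k x y"
  shows "property_tau M W"
  unfolding property_tau_def
proof (intro allI impI, elim conjE)
  fix f :: "'a \<Rightarrow> real" assume [measurable]: "f \<in> borel_measurable borel"
  let ?b = "\<integral>\<^sup>+x. ennreal (exp (- f x)) \<partial>M"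
  have "integral\<^sup>S M g * ?b \<le> 1" if g: "simple_function M g" and gh: "g \<le> (\<lambda>x. eexp (inf_conv W f x))" for g
  proof -
    have "(\<integral>\<^sup>+x. g x \<partial>M) * ?b \<le> 1"
    proof (rule tau_kernelD[OF k])
      show "g \<in> borel_measurable M" using g by (rule borel_measurable_simple_function)
      fix x y
      have "g x \<le> eexp (inf_conv W f x)" using gh by (simp add: le_fun_def)
      also have "\<dots> \<le> eexp (W (x - y) + ereal (f y))"
        unfolding inf_conv_def by (intro eexp_mono INF_lower) auto
      also have "\<dots> = eexp (W (x - y)) * ennreal (exp (f y))" by (rule eexp_add_real)
      finally have "g x * ennreal (exp (- f y)) \<le> eexp (W (x - y)) * ennreal (exp (f y)) * ennreal (exp (- f y))"
        by (intro mult_right_mono) auto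
      also have "\<dots> = eexp (W (x - y))"
        by (simp add: mult.assoc flip: ennreal_mult exp_add)
      also have "\<dots> \<le> k x y" by (rule le)
      finally show "g x * ennreal (exp (- f y)) \<le> k x y" .
    qed measurable
    then show ?thesis using g by (simp add: nn_integral_eq_simple_integral)
  qed
  then show "(\<integral>\<^sup>+x. eexp (inf_conv W f x) \<partial>M) * ?b \<le> 1"
    unfolding nn_integral_def[of M "\<lambda>x. eexp (inf_conv W f x)"] SUP_mult_right_ennreal
    by (intro SUP_least) auto
qed

lemma nn_integral_exp_symmetrization:
  fixes M :: "'a::euclidean_space measure"
  assumes "prob_space M" and sets[measurable_cong]: "sets M = sets borel"
  shows "(\<integral>\<^sup>+x. ennreal (exp (x \<bullet> y)) \<partial>symmetrization M) =
    (\<integral>\<^sup>+x. ennreal (exp (x \<bullet> y)) \<partial>M) * (\<integral>\<^sup>+x. ennreal (exp (x \<bullet> - y)) \<partial>M)"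
proof -
  interpret prob_space M by fact
  interpret R: prob_space "reflect_measure M"
    unfolding reflect_measure_def by (rule prob_space_distr) measurable
  interpret pair_sigma_finite M "reflect_measure M" ..
  have [measurable_cong]: "sets (reflect_measure M) = sets borel" by (simp add: reflect_measure_def)
  have "(\<integral>\<^sup>+x. ennreal (exp (x \<bullet> y)) \<partial>symmetrization M) =
      (\<integral>\<^sup>+z. ennreal (exp ((fst z + snd z) \<bullet> y)) \<partial>(M \<Otimes>\<^sub>M reflect_measure M))"
    unfolding symmetrization_def conv_measure_def by (subst nn_integral_distr) (auto simp: split_beta)
  also have "\<dots> = (\<integral>\<^sup>+x. \<integral>\<^sup>+z. ennreal (exp (x \<bullet> y)) * ennreal (exp (z \<bullet> y)) \<partial>reflect_measure M \<partial>M)"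
    by (subst R.nn_integral_fst[symmetric]) (auto simp: inner_add_left exp_add ennreal_mult)
  also have "\<dots> = (\<integral>\<^sup>+x. ennreal (exp (x \<bullet> y)) \<partial>M) * (\<integral>\<^sup>+z. ennreal (exp (z \<bullet> y)) \<partial>reflect_measure M)"
    by (simp add: nn_integral_cmult nn_integral_multc)
  also have "(\<integral>\<^sup>+z. ennreal (exp (z \<bullet> y)) \<partial>reflect_measure M) = (\<integral>\<^sup>+x. ennreal (exp (x \<bullet> - y)) \<partial>M)"
    unfolding reflect_measure_def by (subst nn_integral_distr) auto
  finally show ?thesis .
qed

text \<open>The rule fails for a factor 0 next to an infinite one; the lower bound 1 excludes
  this.\<close>

lemma inverse_prod_ennreal:
  fixes f :: "'i \<Rightarrow> ennreal"
  assumes "\<And>i. i \<in> I \<Longrightarrow> 1 \<le> f i"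
  shows "inverse (\<Prod>i\<in>I. f i) = (\<Prod>i\<in>I. inverse (f i))"
  using assms
proof (induction I rule: infinite_finite_induct)
  case (insert i I)
  have "1 \<le> (\<Prod>i\<in>I. f i)" using insert.prems by (intro prod_ge_1) auto
  then have "0 < (\<Prod>i\<in>I. f i)" "0 < f i"
    using insert.prems[of i] by (auto intro: less_le_trans[OF zero_less_one])
  with insert show ?case by (simp add: ennreal_inverse_mult')
qed auto

theorem theorem4:
  fixes \<mu> :: "(real ^ 'n) measure" and \<delta> :: real
  assumes "prob_space \<mu>" and "sets \<mu> = sets borel"
    and "symmetric_measure \<mu>" and "product_measure \<mu>" and "log_concave_measure \<mu>"
    and "full_dim_support \<mu>"
    and "\<delta> > 0" and "log_laplace_conj sym_exp \<delta> = ereal (ln 2 + 1 / sqrt 3)"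
  shows "IC (2 * sqrt 3 * \<delta>) \<mu>"
proof -
  define \<beta> where "\<beta> = 2 * sqrt 3 * \<delta>"
  have \<beta>: "77 / 10 \<le> \<beta>" using scale_lower_bound[OF assms(7,8)] by (simp add: \<beta>_def)
  note [measurable_cong] = assms(2)
  obtain Ms :: "'n \<Rightarrow> real measure" where "\<forall>i. prob_space (Ms i) \<and> sets (Ms i) = sets borel"
    and \<mu>: "\<mu> = distr (PiM UNIV Ms) borel (\<lambda>f. \<chi> i. f i)"
    using assms(4) unfolding product_measure_def by blast
  then have Ms: "prob_space (Ms i)" and sets_Ms: "sets (Ms i) = sets borel" for i by auto
  note [measurable_cong] = sets_Ms
  interpret Ms: prob_space "Ms i" for i by (rule Ms)
  interpret product_sigma_finite Ms ..
  have vec[measurable]: "(\<lambda>f. (\<chi> i. f i) :: real ^ 'n) \<in> borel_measurable (PiM UNIV Ms)"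
    by (subst borel_measurable_euclidean_space) (auto simp: Basis_vec_def inner_axis)
  have marginal: "Ms i = distr \<mu> borel (\<lambda>x. x $ i)" for i
  proof -
    have "distr \<mu> borel (\<lambda>x. x $ i) = distr (PiM UNIV Ms) (Ms i) (\<lambda>f. f i)"
      unfolding \<mu> by (subst distr_distr) (auto simp: comp_def sets_Ms intro!: distr_cong)
    also have "\<dots> = Ms i" by (rule distr_PiM_component) (auto intro: Ms)
    finally show ?thesis ..
  qed
  have sym: "distr (Ms i) borel uminus = Ms i" for i
  proof -
    have "distr (Ms i) borel uminus = distr (distr \<mu> borel uminus) borel (\<lambda>x. x $ i)"
      unfolding marginal[of i] by (subst (1 2) distr_distr) (auto simp: comp_def)
    also have "distr \<mu> borel uminus = \<mu>"
      using assms(3) by (simp add: symmetric_measure_def reflect_measure_def)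
    finally show ?thesis by (simp add: marginal)
  qed
  interpret marg: symmetric_log_concave_cdf "Ms i" for i
  proof
    show "sets (Ms i) = sets borel" by (rule sets_Ms)
    show "distr (Ms i) borel uminus = Ms i" by (rule sym)
    show "cdf (Ms i) x powr u * cdf (Ms i) y powr (1 - u) \<le> cdf (Ms i) (u * x + (1 - u) * y)"
      if "0 \<le> u" "u \<le> 1" for u x y
      unfolding marginal[of i] by (rule cdf_marginal_log_concave[OF assms(1,2,5) that])
  qed
  \<comment> \<open>The Laplace transform of a product law factorises, so the exponentiated
    conjugate for \<mu> is bounded by the product of these coordinate kernels. The term l = 0 gives
    the lower bound 1 that \<open>tau_kernel_PiM\<close> asks for.\<close>
  define k where "k i x y = (SUP l. ennreal (exp (l * (x - y) / \<beta>)) / (marg.mgf i l * marg.mgf i (- l)))" for i x y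
  have k_ge: "ennreal (exp (l * (x - y) / \<beta>)) / (marg.mgf i l * marg.mgf i (- l)) \<le> k i x y" for i l x y
    unfolding k_def by (rule SUP_upper) simp
  have mgf_0: "marg.mgf i 0 = 1" for i
    using Ms.emeasure_space_1[of i] by (simp add: marg.mgf_def)
  have k_ge_1: "1 \<le> k i x y" for i x y
    using k_ge[of 0 x y i] by (simp add: mgf_0)
  have "tau_kernel (PiM UNIV Ms) (\<lambda>x y. \<Prod>i\<in>UNIV. k i (x i) (y i))"
  proof (rule tau_kernel_PiM)
    show "sigma_finite_measure (Ms i)" for i by unfold_locales
    show "tau_kernel (Ms i) (k i)" for i
      unfolding k_def[abs_def] by (rule marg.tau_kernel_marginal[OF \<beta>])
  qed (simp_all add: k_ge_1)
  then have "tau_kernel \<mu> (\<lambda>x y. \<Prod>i\<in>UNIV. k i (x $ i) (y $ i))"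
    unfolding \<mu> by (rule tau_kernel_distr[OF _ vec]) simp
  moreover have "eexp (log_laplace_conj (symmetrization \<mu>) ((1 / \<beta>) *\<^sub>R (x - y))) \<le> (\<Prod>i\<in>UNIV. k i (x $ i) (y $ i))" for x y
    unfolding log_laplace_conj_def
  proof (rule eexp_SUP_le)
    show "0 < (\<Prod>i\<in>UNIV. k i (x $ i) (y $ i))"
      using prod_ge_1[of UNIV "\<lambda>i. k i (x $ i) (y $ i)"] k_ge_1 by (auto intro: less_le_trans[OF zero_less_one])
    fix l :: "real ^ 'n"
    have mgf: "(\<integral>\<^sup>+x. ennreal (exp (x \<bullet> l)) \<partial>\<mu>) = (\<Prod>i\<in>UNIV. marg.mgf i (l $ i))" for l
    proof -
      have "(\<integral>\<^sup>+x. ennreal (exp (x \<bullet> l)) \<partial>\<mu>) = (\<integral>\<^sup>+f. (\<Prod>i\<in>UNIV. ennreal (exp (l $ i * f i))) \<partial>PiM UNIV Ms)"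
        unfolding \<mu> by (subst nn_integral_distr) (auto simp: inner_vec_def exp_sum prod_ennreal mult.commute)
      also have "\<dots> = (\<Prod>i\<in>UNIV. marg.mgf i (l $ i))"
        unfolding marg.mgf_def by (rule product_nn_integral_prod) auto
      finally show ?thesis .
    qed
    let ?m = "\<lambda>i. marg.mgf i (l $ i) * marg.mgf i (- l $ i)"
    have I: "(\<integral>\<^sup>+x. ennreal (exp (x \<bullet> l)) \<partial>symmetrization \<mu>) = (\<Prod>i\<in>UNIV. ?m i)"
      unfolding nn_integral_exp_symmetrization[OF assms(1,2)] mgf by (simp add: prod.distrib)
    have m1: "1 \<le> ?m i" for i
      using mult_mono[OF marg.mgf_ge_1 marg.mgf_ge_1, of i "l $ i" i "- l $ i"] by simp
    then have "1 \<le> (\<Prod>i\<in>UNIV. ?m i)" by (intro prod_ge_1) auto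
    then have "(\<Prod>i\<in>UNIV. ?m i) \<noteq> 0" by (metis not_one_le_zero)
    then have "eexp (ereal ((1 / \<beta>) *\<^sub>R (x - y) \<bullet> l) - log_laplace (symmetrization \<mu>) l) =
        ennreal (exp ((1 / \<beta>) *\<^sub>R (x - y) \<bullet> l)) / (\<Prod>i\<in>UNIV. ?m i)"
      using I by (subst eexp_diff_log_laplace) simp_all
    also have "exp ((1 / \<beta>) *\<^sub>R (x - y) \<bullet> l) = (\<Prod>i\<in>UNIV. exp (l $ i * (x $ i - y $ i) / \<beta>))"
      by (simp add: inner_vec_def sum_divide_distrib mult.commute flip: exp_sum)
    also have "ennreal \<dots> / (\<Prod>i\<in>UNIV. ?m i) = (\<Prod>i\<in>UNIV. ennreal (exp (l $ i * (x $ i - y $ i) / \<beta>)) / ?m i)"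
      unfolding divide_ennreal_def inverse_prod_ennreal[of UNIV ?m, OF m1]
      by (simp add: prod.distrib prod_ennreal)
    also have "\<dots> \<le> (\<Prod>i\<in>UNIV. k i (x $ i) (y $ i))"
      by (intro prod_mono_ennreal k_ge)
    finally show "eexp (ereal ((1 / \<beta>) *\<^sub>R (x - y) \<bullet> l) - log_laplace (symmetrization \<mu>) l) \<le>
      (\<Prod>i\<in>UNIV. k i (x $ i) (y $ i))" .
  qed
  ultimately show ?thesis
    unfolding IC_def \<beta>_def[symmetric] by (intro property_tau_if_tau_kernel[OF assms(2)]) auto
qed

end
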